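(* Consider a parameterized MDP with finite state space $\mathcal{S}$, finite action space $\mathcal{A}$ and finite parameter set $\Theta$, with optimal stationary policies $\mu_\theta^*$, $\theta\in\Theta$ (as in the context). Assume: (1) for every $\theta\in\Theta$, the state process induced by $\mu_\theta^*$ under parameter $\theta$ is ergodic unichain; (2) there exists $s^*\in\mathcal{S}$ such that $\mu_\theta^*(s^* )$ is an informative action in state $s^*$ for all $\theta\in\Theta$; (3) there exists a stationary policy $\bar\mu$ such that the Markov chain induced by $\bar\mu$ is ergodic, and, with probability 1, $N^{\mu}(t;s^* )\ge N^{\bar\mu}(t;s^* )$ for all $t$, for every policy $\mu\in\Pi_C$; (4) the prior satisfies $\pi_0(\theta)>0$ for all $\theta\in\Theta$. Then for every $\theta\in\Theta$ there exist constants $a_\theta>0$ and $b_\theta>0$ such that, when actions are selected by Thompson sampling and the true parameter is $\theta$, the posterior $\pi_t$ satisfies $$\mathbb{E}_\theta\big[1-\pi_t(\theta)\big]\ \le\ a_\theta e^{-b_\theta t},\qquad \forall\, t\ge 0 .$$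
   Context: Parameterized MDP: finite sets $\mathcal{S}$ (states), $\mathcal{A}$ (actions), $\Theta$ (parameters). Under parameter $\theta$, if action $a$ is applied in state $s$ at time $t$, then (independently of each other, and of the past given $(s,a)$) the next state is drawn as $S_{t+1}\sim p_\theta(\cdot\mid s,a)$ and the reward as $R_t\sim q_\theta(\cdot\mid s,a)$, where $q_\theta(\cdot\mid s,a)$ is a density (with respect to a common dominating measure). The reward function $r_\theta(s,a)=\mathbb{E}_\theta[R\mid s,a]$ is bounded on $\mathcal{S}\times\mathcal{A}$. The initial state $S_0=s_0$ is fixed. $\mathbb{P}_\theta,\mathbb{E}_\theta$ denote probability and expectation when the true parameter is $\theta$. Policies: the history is $H_t=(S_0,A_0,R_0,\dots,S_{t-1},A_{t-1},R_{t-1},S_t)$. An admissible policy is a sequence $(\mu_t)_{t\ge0}$ mapping $H_t$ to a probability distribution on $\mathcal{A}$, from which $A_t$ is drawn; $\Pi$ is the set of admissible policies. A stationary policy is given by a single map $\mathcal{S}\to\mathcal{A}$. For each $\theta$, $\mu_\theta^*$ is a fixed stationary policy maximizing over $\Pi$ the long-run average reward $J_\theta^\mu(s_0)=\limsup_{T\to\infty}\frac1T\mathbb{E}_\theta\big[\sum_{t=0}^{T-1}r_\theta(S_t,A_t)\big]$ (assumed to exist). "Ergodic unichain": a single recurrent class, aperiodic, plus possibly some transient states. "Ergodic" (for the finite chain induced by $\bar\mu$, under each parameter $\theta$): irreducible and aperiodic. Informative actions: $\nu_\theta(s,a)$ is the joint (product) distribution of reward and next state given by $q_\theta(\cdot\mid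 s,a)\,p_\theta(\cdot\mid s,a)$. It is assumed that for all $\theta,\gamma\in\Theta$ and all $(s,a)$, $\nu_\gamma(s,a)$ is absolutely continuous with respect to $\nu_\theta(s,a)$, and that the Kullback–Leibler divergence $\mathcal{K}(\nu_\theta(s,a)\,|\,\nu_\gamma(s,a))=\mathbb{E}_\theta\Big[\log\frac{q_\theta(R\mid s,a)p_\theta(S'\mid s,a)}{q_\gamma(R\mid s,a)p_\gamma(S'\mid s,a)}\Big]$ is finite, where $(R,S')\sim\nu_\theta(s,a)$. Action $a$ is informative in state $s$ if $\mathcal{K}(\nu_\theta(s,a)\,|\,\nu_\gamma(s,a))>0$ for any two distinct $\theta,\gamma\in\Theta$. Counts: for a policy $\mu$, with $(S_i)$ evolving under $\mu$, $N^\mu(t;s)=\sum_{i=0}^{t-1}\mathbf{1}\{S_i=s\}$. $\Pi_C$: let $\mathcal{A}^*(s)=\{a\in\mathcal{A}: a=\mu_\theta^*(s)\text{ for some }\theta\in\Theta\}$; $\Pi_C\subset\Pi$ is the set of (possibly history-dependent, randomized) policies that in every state $s$ only choose actions in $\mathcal{A}^*(s)$. In hypothesis (3), the comparison of counts under two policies is understood as follows: for each true parameter $\theta$, the processes under $\mu$ and under $\bar\mu$, both started at $s_0$, can be defined on a common probability space on which, with probability 1, the inequality holds for all $t$. Thompson sampling: given a prior $\pi_0$ on $\Theta$, the posterior is $\pi_t(\theta)=\frac{\mathcal{L}_\theta(H_t)\pi_0(\theta)}{\sum_{\gamma\in\Theta}\mathcal{L}_\gamma(H_t)\pi_0(\gamma)}$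 with $\mathcal{L}_\theta(H_t)=\prod_{i=1}^t q_\theta(R_{i-1}\mid S_{i-1},A_{i-1})\,p_\theta(S_i\mid S_{i-1},A_{i-1})$. At each time $t$, sample $\theta_t\sim\pi_t$ (given $H_t$) and apply $A_t=\mu_{\theta_t}^*(S_t)$. *)

theory Defs
  imports "HOL-Probability.Probability"
begin

section \<open>Finite Markov chains\<close>

primrec n_step :: "('s \<Rightarrow> 's pmf) \<Rightarrow> nat \<Rightarrow> 's \<Rightarrow> 's pmf" where
  "n_step K 0 x = return_pmf x"
| "n_step K (Suc n) x = bind_pmf (K x) (n_step K n)"

definition accessible :: "('s \<Rightarrow> 's pmf) \<Rightarrow> 's \<Rightarrow> 's \<Rightarrow> bool" where
  "accessible K x y \<longleftrightarrow> (\<exists>n. 0 < pmf (n_step K n x) y)"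

definition period :: "('s \<Rightarrow> 's pmf) \<Rightarrow> 's \<Rightarrow> nat" where
  "period K x = Gcd {n. 0 < n \<and> 0 < pmf (n_step K n x) x}"

text \<open>\<open>first_passage K y n x\<close> is the probability that the chain started in \<open>x\<close> visits \<open>y\<close>
  at time \<open>Suc n\<close> and at none of the times \<open>1, \<dots>, n\<close>.\<close>

primrec first_passage :: "('s::finite \<Rightarrow> 's pmf) \<Rightarrow> 's \<Rightarrow> nat \<Rightarrow> 's \<Rightarrow> real" where
  "first_passage K y 0 x = pmf (K x) y"
| "first_passage K y (Suc n) x = (\<Sum>z\<in>UNIV - {y}. pmf (K x) z * first_passage K y n z)"

text \<open>Recurrence: the chain returns to its starting state with probability one.\<close>

definition recurrent :: "('s::finite \<Rightarrow> 's pmf) \<Rightarrow> 's \<Rightarrow> bool" where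
  "recurrent K x \<longleftrightarrow> (\<lambda>n. first_passage K x n x) sums 1"

definition recurrent_class :: "('s::finite \<Rightarrow> 's pmf) \<Rightarrow> 's set \<Rightarrow> bool" where
  "recurrent_class K C \<longleftrightarrow>
     (\<exists>x. recurrent K x \<and> C = {y. accessible K x y \<and> accessible K y x})"

definition ergodic_unichain :: "('s::finite \<Rightarrow> 's pmf) \<Rightarrow> bool" where
  "ergodic_unichain K \<longleftrightarrow> (\<exists>!C. recurrent_class K C) \<and> (\<forall>x. recurrent K x \<longrightarrow> period K x = 1)"

definition ergodic :: "('s::finite \<Rightarrow> 's pmf) \<Rightarrow> bool" where
  "ergodic K \<longleftrightarrow> (\<forall>x y. accessible K x y) \<and> (\<forall>x. period K x = 1)"


section \<open>Parameterized Markov decision processes\<close>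

text \<open>The finite sets of states, actions and parameters are finite types. The components are the
  transition probabilities, the reward densities, the measure with respect to which these are
  densities, and the initial state.\<close>

record ('s, 'a, 'p) pmdp =
  tprob :: "'p \<Rightarrow> 's \<Rightarrow> 'a \<Rightarrow> 's pmf"
  rdens :: "'p \<Rightarrow> 's \<Rightarrow> 'a \<Rightarrow> real \<Rightarrow> real"
  base :: "real measure"
  start :: 's

definition reward_law :: "('s, 'a, 'p) pmdp \<Rightarrow> 'p \<Rightarrow> 's \<Rightarrow> 'a \<Rightarrow> real measure" where
  "reward_law M \<theta> s a = density (base M) (\<lambda>x. ennreal (rdens M \<theta> s a x))"

definition reward :: "('s, 'a, 'p) pmdp \<Rightarrow> 'p \<Rightarrow> 's \<Rightarrow> 'a \<Rightarrow> real" where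
  "reward M \<theta> s a = (\<integral>x. x \<partial>reward_law M \<theta> s a)"

text \<open>Joint law of the reward and the next state.\<close>

definition outcome_law :: "('s, 'a, 'p) pmdp \<Rightarrow> 'p \<Rightarrow> 's \<Rightarrow> 'a \<Rightarrow> (real \<times> 's) measure" where
  "outcome_law M \<theta> s a = reward_law M \<theta> s a \<Otimes>\<^sub>M measure_pmf (tprob M \<theta> s a)"

definition log_ratio :: "('s, 'a, 'p) pmdp \<Rightarrow> 'p \<Rightarrow> 'p \<Rightarrow> 's \<Rightarrow> 'a \<Rightarrow> real \<times> 's \<Rightarrow> real" where
  "log_ratio M \<theta> \<gamma> s a = (\<lambda>(x, s').
     ln ((rdens M \<theta> s a x * pmf (tprob M \<theta> s a) s') / (rdens M \<gamma> s a x * pmf (tprob M \<gamma> s a) s')))"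

definition kl :: "('s, 'a, 'p) pmdp \<Rightarrow> 'p \<Rightarrow> 'p \<Rightarrow> 's \<Rightarrow> 'a \<Rightarrow> real" where
  "kl M \<theta> \<gamma> s a = (\<integral>z. log_ratio M \<theta> \<gamma> s a z \<partial>outcome_law M \<theta> s a)"

definition informative :: "('s, 'a, 'p) pmdp \<Rightarrow> 's \<Rightarrow> 'a \<Rightarrow> bool" where
  "informative M s a \<longleftrightarrow> (\<forall>\<theta> \<gamma>. \<theta> \<noteq> \<gamma> \<longrightarrow> 0 < kl M \<theta> \<gamma> s a)"

text \<open>Integrability of the identity says that the mean reward exists; as there are finitely many
  states and actions, the mean reward function is then bounded. Integrability of \<open>log_ratio\<close> is
  finiteness of the Kullback--Leibler divergence, since the negative part of \<open>log_ratio\<close> is always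
  integrable. Note that \<open>absolutely_continuous A B\<close> means that \<open>B\<close> is absolutely continuous
  with respect to \<open>A\<close>.\<close>

definition param_mdp :: "('s::finite, 'a::finite, 'p::finite) pmdp \<Rightarrow> bool" where
  "param_mdp M \<longleftrightarrow>
     sets (base M) = sets borel \<and>
     (\<forall>\<theta> s a. rdens M \<theta> s a \<in> borel_measurable borel \<and> (\<forall>x. 0 \<le> rdens M \<theta> s a x) \<and>
        prob_space (reward_law M \<theta> s a) \<and> integrable (reward_law M \<theta> s a) (\<lambda>x. x)) \<and>
     (\<forall>\<theta> \<gamma> s a. absolutely_continuous (outcome_law M \<theta> s a) (outcome_law M \<gamma> s a) \<and>
        integrable (outcome_law M \<theta> s a) (log_ratio M \<theta> \<gamma> s a))"

lemma bounded_reward: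
  fixes M :: "('s::finite, 'a::finite, 'p) pmdp"
  shows "bounded (range (\<lambda>(s, a). reward M \<theta> s a))"
  by (intro finite_imp_bounded) simp


section \<open>Trajectories and policies\<close>

text \<open>A trajectory \<open>\<omega>\<close> lists the triples (action at time \<open>t\<close>, reward at time \<open>t\<close>, state at time
  \<open>Suc t\<close>). As the initial state is fixed, the history up to and including the state at time \<open>t\<close>
  is the restriction of \<open>\<omega>\<close> to \<open>{0..<t}\<close>.\<close>

type_synonym ('s, 'a) traj = "nat \<Rightarrow> 'a \<times> real \<times> 's"

type_synonym ('s, 'a) policy = "nat \<Rightarrow> ('s, 'a) traj \<Rightarrow> 'a pmf"

abbreviation step_space :: "('a \<times> real \<times> 's) measure" where
  "step_space \<equiv> count_space UNIV \<Otimes>\<^sub>M (borel \<Otimes>\<^sub>M count_space UNIV)"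

abbreviation history_space :: "nat \<Rightarrow> ('s, 'a) traj measure" where
  "history_space t \<equiv> PiM {0..<t} (\<lambda>_. step_space)"

abbreviation traj_space :: "('s, 'a) traj measure" where
  "traj_space \<equiv> PiM UNIV (\<lambda>_. step_space)"

definition state :: "('s, 'a, 'p) pmdp \<Rightarrow> nat \<Rightarrow> ('s, 'a) traj \<Rightarrow> 's" where
  "state M t \<omega> = (case t of 0 \<Rightarrow> start M | Suc i \<Rightarrow> snd (snd (\<omega> i)))"

definition action :: "nat \<Rightarrow> ('s, 'a) traj \<Rightarrow> 'a" where
  "action t \<omega> = fst (\<omega> t)"

definition rew :: "nat \<Rightarrow> ('s, 'a) traj \<Rightarrow> real" where
  "rew t \<omega> = fst (snd (\<omega> t))"

definition policies :: "('s, 'a) policy set" where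
  "policies = {\<mu>. \<forall>t. (\<lambda>h. measure_pmf (\<mu> t h)) \<in> history_space t \<rightarrow>\<^sub>M subprob_algebra (count_space UNIV)}"

definition stationary :: "('s, 'a, 'p) pmdp \<Rightarrow> ('s \<Rightarrow> 'a) \<Rightarrow> ('s, 'a) policy" where
  "stationary M f t h = return_pmf (f (state M t h))"

definition step_kernel :: "('s, 'a, 'p) pmdp \<Rightarrow> 'p \<Rightarrow> ('s, 'a) policy \<Rightarrow> nat \<Rightarrow> ('s, 'a) traj \<Rightarrow>
    ('a \<times> real \<times> 's) measure" where
  "step_kernel M \<theta> \<mu> t h =
     measure_pmf (\<mu> t h) \<bind> (\<lambda>a. distr (outcome_law M \<theta> (state M t h) a) step_space (Pair a))"

text \<open>The law of the trajectory is the Ionescu-Tulcea measure of these kernels.\<close>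

definition traj_law :: "('s, 'a, 'p) pmdp \<Rightarrow> 'p \<Rightarrow> ('s, 'a) policy \<Rightarrow> ('s, 'a) traj measure" where
  "traj_law M \<theta> \<mu> = projective_family.lim UNIV
     (Ionescu_Tulcea.CI (step_kernel M \<theta> \<mu>) (\<lambda>_. step_space)) (\<lambda>_. step_space)"

definition avg_reward :: "('s, 'a, 'p) pmdp \<Rightarrow> 'p \<Rightarrow> ('s, 'a) policy \<Rightarrow> ereal" where
  "avg_reward M \<theta> \<mu> = limsup (\<lambda>T. ereal (1 / real T *
     (\<integral>\<omega>. (\<Sum>t<T. reward M \<theta> (state M t \<omega>) (action t \<omega>)) \<partial>traj_law M \<theta> \<mu>)))"

definition optimal :: "('s, 'a, 'p) pmdp \<Rightarrow> 'p \<Rightarrow> ('s \<Rightarrow> 'a) \<Rightarrow> bool" where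
  "optimal M \<theta> f \<longleftrightarrow> (\<forall>\<mu>\<in>policies. avg_reward M \<theta> \<mu> \<le> avg_reward M \<theta> (stationary M f))"

definition visits :: "('s, 'a, 'p) pmdp \<Rightarrow> 's \<Rightarrow> nat \<Rightarrow> ('s, 'a) traj \<Rightarrow> nat" where
  "visits M s t \<omega> = card {i. i < t \<and> state M i \<omega> = s}"

text \<open>The policies which in every state \<open>s\<close> choose only among the actions \<open>f \<theta> s\<close>.\<close>

definition candidate_policies ::
    "('s, 'a, 'p) pmdp \<Rightarrow> ('p \<Rightarrow> 's \<Rightarrow> 'a) \<Rightarrow> ('s, 'a) policy set" where
  "candidate_policies M f =
     {\<mu> \<in> policies. \<forall>t. \<forall>h\<in>space (history_space t).
        set_pmf (\<mu> t h) \<subseteq> {a. \<exists>\<theta>. a = f \<theta> (state M t h)}}"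

text \<open>The processes under \<open>\<mu>\<close> and \<open>\<mu>'\<close> can be realised on a common probability space such that
  almost surely the former has at all times visited \<open>s\<close> at least as often as the latter. The joint
  law of the two processes serves as the common probability space.\<close>

definition visits_dominate ::
    "('s, 'a, 'p) pmdp \<Rightarrow> 'p \<Rightarrow> 's \<Rightarrow> ('s, 'a) policy \<Rightarrow> ('s, 'a) policy \<Rightarrow> bool" where
  "visits_dominate M \<theta> s \<mu> \<mu>' \<longleftrightarrow>
     (\<exists>Q. prob_space Q \<and> sets Q = sets (traj_space \<Otimes>\<^sub>M traj_space) \<and>
        distr Q traj_space fst = traj_law M \<theta> \<mu> \<and>
        distr Q traj_space snd = traj_law M \<theta> \<mu>' \<and>
        (AE (\<omega>, \<omega>') in Q. \<forall>t. visits M s t \<omega> \<ge> visits M s t \<omega>'))"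


section \<open>Thompson sampling\<close>

definition likelihood :: "('s, 'a, 'p) pmdp \<Rightarrow> 'p \<Rightarrow> nat \<Rightarrow> ('s, 'a) traj \<Rightarrow> real" where
  "likelihood M \<theta> t \<omega> = (\<Prod>i<t. rdens M \<theta> (state M i \<omega>) (action i \<omega>) (rew i \<omega>) *
     pmf (tprob M \<theta> (state M i \<omega>) (action i \<omega>)) (state M (Suc i) \<omega>))"

definition posterior ::
    "('s, 'a, 'p::finite) pmdp \<Rightarrow> 'p pmf \<Rightarrow> nat \<Rightarrow> ('s, 'a) traj \<Rightarrow> 'p \<Rightarrow> real" where
  "posterior M prior t \<omega> \<theta> =
     likelihood M \<theta> t \<omega> * pmf prior \<theta> / (\<Sum>\<gamma>\<in>UNIV. likelihood M \<gamma> t \<omega> * pmf prior \<gamma>)"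

text \<open>On histories of likelihood zero under all parameters in the support of the prior the
  posterior is the quotient 0/0. If the prior has full support, such histories form a null set
  under every parameter; there we sample from the prior, so as to have a policy defined on all
  histories.\<close>

definition posterior_pmf ::
    "('s, 'a, 'p::finite) pmdp \<Rightarrow> 'p pmf \<Rightarrow> nat \<Rightarrow> ('s, 'a) traj \<Rightarrow> 'p pmf" where
  "posterior_pmf M prior t h =
     (if (\<Sum>\<gamma>\<in>UNIV. likelihood M \<gamma> t h * pmf prior \<gamma>) = 0 then prior
      else embed_pmf (posterior M prior t h))"

definition thompson ::
    "('s, 'a, 'p::finite) pmdp \<Rightarrow> 'p pmf \<Rightarrow> ('p \<Rightarrow> 's \<Rightarrow> 'a) \<Rightarrow> ('s, 'a) policy" where
  "thompson M prior f t h = map_pmf (\<lambda>\<theta>. f \<theta> (state M t h)) (posterior_pmf M prior t h)"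


section \<open>Well-definedness\<close>

text \<open>The kernels satisfy the assumptions under which the Ionescu-Tulcea measure exists, and
  Thompson sampling is an admissible policy.\<close>

lemma measurable_state:
  assumes "J \<supseteq> {0..<t}"
  shows "state M t \<in> PiM J (\<lambda>_. step_space) \<rightarrow>\<^sub>M (count_space UNIV :: 's measure)"
proof (cases t)
  case 0
  then show ?thesis by (simp add: state_def[abs_def])
next
  case (Suc i)
  then have "i \<in> J" using assms by auto
  then have "(\<lambda>\<omega>. \<omega> i) \<in> PiM J (\<lambda>_. step_space :: ('a \<times> real \<times> 's) measure) \<rightarrow>\<^sub>M step_space"
    by (rule measurable_component_singleton)
  then show ?thesis unfolding state_def[abs_def] Suc by simp measurable
qed

lemma sets_outcome_law:
  assumes "param_mdp M"
  shows "sets (outcome_law M \<theta> s a) = sets (borel \<Otimes>\<^sub>M count_space UNIV)"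
  unfolding outcome_law_def reward_law_def
  by (rule sets_pair_measure_cong) (use assms in \<open>auto simp: param_mdp_def\<close>)

lemma prob_space_outcome_law:
  assumes "param_mdp M"
  shows "prob_space (outcome_law M \<theta> s a)"
proof -
  interpret A: prob_space "reward_law M \<theta> s a" using assms by (auto simp: param_mdp_def)
  interpret B: prob_space "measure_pmf (tprob M \<theta> s a)" by (rule measure_pmf.prob_space_axioms)
  interpret pair_prob_space "reward_law M \<theta> s a" "measure_pmf (tprob M \<theta> s a)" ..
  show ?thesis unfolding outcome_law_def by (rule prob_space_axioms)
qed

lemma Ionescu_Tulcea_kernel:
  fixes M :: "('s::finite, 'a::finite, 'p::finite) pmdp"
  assumes M: "param_mdp M" and mu: "\<mu> \<in> policies"
  shows "Ionescu_Tulcea (step_kernel M \<theta> \<mu>) (\<lambda>_. step_space)"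
proof -
  have S[simp]: "distr (outcome_law M \<theta> s a) step_space (Pair a) \<in> space (prob_algebra step_space)" for s a
    using sets_outcome_law[OF M, of \<theta> s a]
    by (auto simp: space_prob_algebra intro!: prob_space.prob_space_distr prob_space_outcome_law[OF M]
        cong: measurable_cong_sets)
  have D: "(\<lambda>(s, a). distr (outcome_law M \<theta> s a) step_space (Pair a)) \<in>
      count_space UNIV \<Otimes>\<^sub>M count_space UNIV \<rightarrow>\<^sub>M prob_algebra step_space"
    using S by (simp add: pair_measure_countable Pi_iff split_beta del: S)
  have K: "step_kernel M \<theta> \<mu> i \<in> history_space i \<rightarrow>\<^sub>M subprob_algebra step_space" for i
  proof -
    have m: "(\<lambda>h. measure_pmf (\<mu> i h)) \<in> history_space i \<rightarrow>\<^sub>M subprob_algebra (count_space UNIV)"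
      using mu by (auto simp: policies_def)
    have "(\<lambda>x. (state M i (fst x), snd x)) \<in> history_space i \<Otimes>\<^sub>M count_space UNIV \<rightarrow>\<^sub>M
        count_space UNIV \<Otimes>\<^sub>M (count_space UNIV :: 'a measure)"
      by (intro measurable_Pair measurable_compose[OF measurable_fst measurable_state[of i "{0..<i}" M]]
          measurable_snd order.refl)
    from measurable_compose[OF this D]
    have "(\<lambda>x. distr (outcome_law M \<theta> (state M i (fst x)) (snd x)) step_space (Pair (snd x))) \<in>
        history_space i \<Otimes>\<^sub>M count_space UNIV \<rightarrow>\<^sub>M prob_algebra step_space"
      by simp
    note measurable_prob_algebraD[OF this]
    from measurable_bind[OF m this] have "(\<lambda>h. measure_pmf (\<mu> i h) \<bind> (\<lambda>a. distr (outcome_law M \<theta> (state M i h) a) step_space (Pair a))) \<in> history_space i \<rightarrow>\<^sub>M subprob_algebra step_space" by simp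
    then show ?thesis
      by (subst step_kernel_def[abs_def])
  qed
  have "prob_space (step_kernel M \<theta> \<mu> i x)" for i and x :: "('s, 'a) traj"
    unfolding step_kernel_def
  proof (rule prob_space.prob_space_bind[where S=step_space])
    show "(\<lambda>a. distr (outcome_law M \<theta> (state M i x) a) step_space (Pair a))
        \<in> measure_pmf (\<mu> i x) \<rightarrow>\<^sub>M subprob_algebra step_space"
      using S by (auto simp: space_prob_algebra space_subprob_algebra intro!: prob_space_imp_subprob_space simp del: S)
  qed (use S in \<open>auto simp: space_prob_algebra measure_pmf.prob_space_axioms simp del: S\<close>)
  note * = this
  show ?thesis
  proof (rule Ionescu_Tulcea.intro)
    show "step_kernel M \<theta> \<mu> i \<in> history_space i \<rightarrow>\<^sub>M subprob_algebra step_space" for i by (rule K)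
  qed (rule *)
qed

lemma likelihood_measurable:
  fixes M :: "('s::finite, 'a::finite, 'p::finite) pmdp"
  assumes "param_mdp M" "J \<supseteq> {0..<t}"
  shows "likelihood M \<theta> t \<in> PiM J (\<lambda>_. step_space) \<rightarrow>\<^sub>M borel"
  unfolding likelihood_def[abs_def]
proof (intro borel_measurable_prod borel_measurable_times)
  fix i assume "i \<in> {..<t}"
  then have i: "i \<in> J" "J \<supseteq> {0..<i}" "J \<supseteq> {0..<Suc i}" using assms(2) by auto
  have c: "(\<lambda>\<omega>. \<omega> i) \<in> PiM J (\<lambda>_. step_space :: ('a \<times> real \<times> 's) measure) \<rightarrow>\<^sub>M step_space"
    using i by (intro measurable_component_singleton)
  have r[measurable]: "rew i \<in> PiM J (\<lambda>_. step_space :: ('a \<times> real \<times> 's) measure) \<rightarrow>\<^sub>M borel"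
    unfolding rew_def[abs_def] using c by measurable
  have a[measurable]: "action i \<in> PiM J (\<lambda>_. step_space :: ('a \<times> real \<times> 's) measure) \<rightarrow>\<^sub>M count_space UNIV"
    unfolding action_def[abs_def] using c by measurable
  note s[measurable] = measurable_state[OF i(2), of M] measurable_state[OF i(3), of M]
  have q: "rdens M \<theta> s a \<in> borel_measurable borel" for s a using assms(1) by (auto simp: param_mdp_def)
  show "(\<lambda>\<omega>. rdens M \<theta> (state M i \<omega>) (action i \<omega>) (rew i \<omega>)) \<in> borel_measurable (PiM J (\<lambda>_. step_space))"
    by (rule measurable_compose_countable'[where I=UNIV, OF measurable_compose_countable'[where I=UNIV and g="action i", OF measurable_compose[OF r q]]])
       (auto)
  show "(\<lambda>\<omega>. pmf (tprob M \<theta> (state M i \<omega>) (action i \<omega>)) (state M (Suc i) \<omega>)) \<in> borel_measurable (PiM J (\<lambda>_. step_space))"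
    by measurable
qed

lemma likelihood_nonneg: "param_mdp M \<Longrightarrow> 0 \<le> likelihood M \<theta> t h"
  unfolding likelihood_def by (intro prod_nonneg) (auto simp: param_mdp_def)

lemma pmf_posterior:
  assumes M: "param_mdp M"
  shows "pmf (posterior_pmf M prior t h) \<theta> =
   (if (\<Sum>\<gamma>\<in>UNIV. likelihood M \<gamma> t h * pmf prior \<gamma>) = 0 then pmf prior \<theta> else posterior M prior t h \<theta>)"
proof (cases "(\<Sum>\<gamma>\<in>UNIV. likelihood M \<gamma> t h * pmf prior \<gamma>) = 0")
  case False
  have nn: "0 \<le> posterior M prior t h x" for x
    unfolding posterior_def
    by (intro divide_nonneg_nonneg mult_nonneg_nonneg sum_nonneg likelihood_nonneg[OF M] pmf_nonneg)
  have "(\<Sum>x\<in>UNIV. posterior M prior t h x) = 1"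
    unfolding posterior_def sum_divide_distrib[symmetric] using False by simp
  then have "(\<integral>\<^sup>+x. ennreal (posterior M prior t h x) \<partial>count_space UNIV) = 1"
    by (simp add: nn_integral_count_space_finite nn)
  from pmf_embed_pmf[OF nn this] False show ?thesis by (simp add: posterior_pmf_def)
qed (simp add: posterior_pmf_def)

lemma thompson_candidate:
  fixes M :: "('s::finite, 'a::finite, 'p::finite) pmdp"
  assumes M: "param_mdp M"
  shows "thompson M prior f \<in> candidate_policies M f"
proof -
  have "(\<lambda>h. measure_pmf (thompson M prior f t h)) \<in> history_space t \<rightarrow>\<^sub>M subprob_algebra (count_space UNIV)" for t
  proof (rule measurable_subprob_algebra)
    note [measurable] = likelihood_measurable[OF M order.refl] measurable_state[OF order.refl, where M=M]
    fix A :: "'a set"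
    have "emeasure (measure_pmf (thompson M prior f t h)) A = 
       (\<Sum>\<theta>\<in>UNIV. ennreal (pmf (posterior_pmf M prior t h) \<theta>) * indicator A (f \<theta> (state M t h)))" for h
      using emeasure_measure_pmf_finite[of "(\<lambda>\<theta>. f \<theta> (state M t h)) -` A" "posterior_pmf M prior t h"]
      unfolding thompson_def
      by (simp add: emeasure_map_pmf sum.If_cases indicator_def vimage_def if_distrib cong: if_cong)
    then show "(\<lambda>h. emeasure (measure_pmf (thompson M prior f t h)) A) \<in> borel_measurable (history_space t)"
      unfolding pmf_posterior[OF M] posterior_def by simp
  qed (auto intro: prob_space_imp_subprob_space measure_pmf.prob_space_axioms)
  then show ?thesis
    by (auto simp: candidate_policies_def policies_def thompson_def)
qed

end

theory Submission
  imports Defs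
begin

text \<open>Let \<open>\<theta>\<close> be the true parameter and \<open>\<gamma>\<close> another one. Under any policy, the square root of the
  likelihood ratio of \<open>\<gamma>\<close> to \<open>\<theta>\<close> is multiplied in each step, in conditional mean, by the Hellinger
  affinity of the two outcome laws. The affinity is at most 1, and at \<open>s_star\<close> every candidate action
  is informative, so that there it is at most some \<open>r < 1\<close>. Hence the root of the ratio divided by
  \<open>r ^ visits\<close> has mean at most 1. By domination, the mean of \<open>r ^ visits\<close> is at most its value
  under \<open>mu_bar\<close>, which decays exponentially since the chain of \<open>mu_bar\<close> is finite and irreducible.
  A cutoff argument combines the two bounds.\<close>

section \<open>The law of the next step given the history\<close>

text \<open>The marginals of the limit measure are given through \<open>CI J\<close>, which runs the
  kernels up to \<open>up_to J\<close> and then restricts. For an initial segment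
  \<open>up_to\<close> is \<open>n\<close> itself, so the marginal is the plain
  \<open>n\<close>-fold composition, started from the empty history
  \<open>\<lambda>x. undefined\<close>.\<close>

lemma (in Ionescu_Tulcea) C_eq_distr_lim:
  "C 0 n (\<lambda>x. undefined) = distr PF.lim (PiM {0..<n} M) (\<lambda>\<omega>. restrict \<omega> {0..<n})"
proof -
  have "up_to {0..<n} = n"
    by (intro antisym) (simp_all add: up_to_iff_Ico, use up_to[of "{0..<n}"] in force)
  then show ?thesis
    using distr_C[OF order.refl, of "\<lambda>x. undefined" 0 n]
    by (simp add: distr_lim CI_def)
qed

lemma (in Ionescu_Tulcea) nn_integral_lim_restrict:
  assumes "f \<in> borel_measurable (PiM {0..<n} M)"
  shows "(\<integral>\<^sup>+\<omega>. f (restrict \<omega> {0..<n}) \<partial>PF.lim) = (\<integral>\<^sup>+h. f h \<partial>C 0 n (\<lambda>x. undefined))"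
  unfolding C_eq_distr_lim using assms
  by (subst nn_integral_distr) (auto simp: measurable_cong_sets[OF PF.sets_lim refl] intro!: measurable_restrict_subset)

text \<open>The composition of \<open>Suc n\<close> kernels is the composition of \<open>n\<close>
  kernels followed by the kernel at time \<open>n\<close>. This disintegration of one step underlies
  every induction over time below.\<close>

lemma (in Ionescu_Tulcea) nn_integral_lim_Suc:
  assumes f[measurable]: "f \<in> borel_measurable (PiM {0..<Suc n} M)"
  shows "(\<integral>\<^sup>+\<omega>. f (restrict \<omega> {0..<Suc n}) \<partial>PF.lim) =
    (\<integral>\<^sup>+\<omega>. (\<integral>\<^sup>+x. f ((restrict \<omega> {0..<n})(n := x)) \<partial>P n (restrict \<omega> {0..<n})) \<partial>PF.lim)"
proof -
  have *: "(\<lambda>h. \<integral>\<^sup>+x. f x \<partial>eP n h) \<in> borel_measurable (PiM {0..<n} M)"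
    by measurable
  have "(\<integral>\<^sup>+\<omega>. f (restrict \<omega> {0..<Suc n}) \<partial>PF.lim) = (\<integral>\<^sup>+h. f h \<partial>(C 0 n (\<lambda>x. undefined) \<bind> eP n))"
    using nn_integral_lim_restrict[OF f] by simp
  also have "\<dots> = (\<integral>\<^sup>+h. \<integral>\<^sup>+x. f x \<partial>eP n h \<partial>C 0 n (\<lambda>x. undefined))"
    by (rule nn_integral_bind[OF f]) (simp add: measurable_cong_sets[OF sets_C refl])
  also have "\<dots> = (\<integral>\<^sup>+\<omega>. \<integral>\<^sup>+x. f x \<partial>eP n (restrict \<omega> {0..<n}) \<partial>PF.lim)"
    using nn_integral_lim_restrict[OF *] by simp
  also have "\<dots> = (\<integral>\<^sup>+\<omega>. (\<integral>\<^sup>+x. f ((restrict \<omega> {0..<n})(n := x)) \<partial>P n (restrict \<omega> {0..<n})) \<partial>PF.lim)"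
    by (intro nn_integral_cong nn_integral_eP f) (auto simp: space_PiM)
  finally show ?thesis .
qed

section \<open>The trajectory law of a policy\<close>

lemma space_step_space[simp]: "space step_space = UNIV"
  by (simp add: space_pair_measure)

lemma prob_space_traj_law:
  fixes M :: "('s::finite, 'a::finite, 'p::finite) pmdp"
  assumes "param_mdp M" "\<mu> \<in> policies"
  shows "prob_space (traj_law M \<theta> \<mu>)"
    and sets_traj_law: "sets (traj_law M \<theta> \<mu>) = sets traj_space"
proof -
  interpret Ionescu_Tulcea "step_kernel M \<theta> \<mu>" "\<lambda>_. step_space"
    by (rule Ionescu_Tulcea_kernel[OF assms])
  show "sets (traj_law M \<theta> \<mu>) = sets traj_space"
    unfolding traj_law_def by (rule PF.sets_lim)
  \<comment> \<open>Total mass is preserved by images, so it can be read off from any marginal; the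
    empty index set is the simplest.\<close>
  have "(\<lambda>\<omega>. restrict \<omega> {}) \<in> PF.lim \<rightarrow>\<^sub>M PiM {} (\<lambda>_. step_space)"
    by (auto simp: measurable_cong_sets[OF PF.sets_lim refl] intro!: measurable_restrict_subset)
  then show "prob_space (traj_law M \<theta> \<mu>)"
    unfolding traj_law_def by (rule prob_space_distrD) (simp add: distr_lim PF.prob_space_P)
qed

lemma measurable_Pair_outcome_law:
  assumes "param_mdp M"
  shows "Pair a \<in> outcome_law M \<theta> s a \<rightarrow>\<^sub>M step_space"
  using sets_outcome_law[OF assms, of \<theta> s a]
  by (auto cong: measurable_cong_sets)

lemma nn_integral_step_kernel:
  assumes M: "param_mdp M" and [measurable]: "G \<in> borel_measurable step_space"
  shows "(\<integral>\<^sup>+z. G z \<partial>step_kernel M \<theta> \<mu> t h) =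
    (\<integral>\<^sup>+a. \<integral>\<^sup>+y. G (a, y) \<partial>outcome_law M \<theta> (state M t h) a \<partial>measure_pmf (\<mu> t h))"
proof -
  note [measurable] = measurable_Pair_outcome_law[OF M]
  have "(\<lambda>a. distr (outcome_law M \<theta> (state M t h) a) step_space (Pair a))
      \<in> measure_pmf (\<mu> t h) \<rightarrow>\<^sub>M subprob_algebra step_space"
    by (auto simp: space_subprob_algebra intro!: prob_space_imp_subprob_space
        prob_space.prob_space_distr prob_space_outcome_law[OF M])
  then show ?thesis
    unfolding step_kernel_def
    by (subst nn_integral_bind[where B=step_space]) (simp_all add: nn_integral_distr)
qed

lemma state_restrict[simp]: "state M t (restrict \<omega> {0..<t}) = state M t \<omega>"
  by (simp add: state_def split: nat.split)

text \<open>Tower property at time \<open>t\<close>: the factor \<open>G\<close> is replaced by its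
  conditional mean given the history. That \<open>F\<close> depends on the history alone is
  expressed by invariance under \<open>restrict\<close>. The current state is a separate argument of
  \<open>G\<close> because \<open>\<omega> t\<close> holds only the action, the reward and the next
  state; as there are finitely many states, measurability for each of them suffices.\<close>

lemma nn_integral_traj_law_step:
  fixes M :: "('s::finite, 'a::finite, 'p::finite) pmdp"
  assumes M: "param_mdp M" and mu: "\<mu> \<in> policies"
    and F: "F \<in> borel_measurable (history_space t)" "\<And>\<omega>. F (restrict \<omega> {0..<t}) = F \<omega>"
    and G: "\<And>s. G s \<in> borel_measurable step_space"
  shows "(\<integral>\<^sup>+\<omega>. F \<omega> * G (state M t \<omega>) (\<omega> t) \<partial>traj_law M \<theta> \<mu>) =
    (\<integral>\<^sup>+\<omega>. F \<omega> * (\<integral>\<^sup>+a. \<integral>\<^sup>+y. G (state M t \<omega>) (a, y) \<partial>outcome_law M \<theta> (state M t \<omega>) a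
      \<partial>measure_pmf (\<mu> t (restrict \<omega> {0..<t}))) \<partial>traj_law M \<theta> \<mu>)"
proof -
  interpret Ionescu_Tulcea "step_kernel M \<theta> \<mu>" "\<lambda>_. step_space"
    by (rule Ionescu_Tulcea_kernel[OF M mu])
  have r[measurable]: "(\<lambda>h. restrict h {0..<t}) \<in> history_space (Suc t) \<rightarrow>\<^sub>M history_space t"
    by (intro measurable_restrict_subset) auto
  have [measurable]: "state M t \<in> history_space (Suc t) \<rightarrow>\<^sub>M count_space UNIV"
    by (rule measurable_state) auto
  have [measurable]: "(\<lambda>h. h t) \<in> history_space (Suc t) \<rightarrow>\<^sub>M step_space"
    by (rule measurable_component_singleton) auto
  \<comment> \<open>Composing with the restriction leaves \<open>F\<close> unchanged and so carries
    its measurability over to the longer histories.\<close>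
  have "(\<lambda>h. F (restrict h {0..<t})) \<in> borel_measurable (history_space (Suc t))"
    using F(1) by measurable
  then have [measurable]: "F \<in> borel_measurable (history_space (Suc t))"
    using F(2) by simp
  have [measurable]: "(\<lambda>h. G (state M t h) (h t)) \<in> borel_measurable (history_space (Suc t))"
    by (rule measurable_compose_countable'[where I=UNIV, OF measurable_compose[OF _ G]]) auto
  have "restrict (restrict \<omega> {0..<Suc t}) {0..<t} = restrict \<omega> {0..<t}"
    "restrict ((restrict \<omega> {0..<t})(t := x)) {0..<t} = restrict \<omega> {0..<t}" for \<omega> and x :: "'a \<times> real \<times> 's"
    by (auto simp: restrict_def fun_eq_iff)
  then have F': "F (restrict \<omega> {0..<Suc t}) = F \<omega>" "F ((restrict \<omega> {0..<t})(t := x)) = F \<omega>" for \<omega> x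
    using F(2) by metis+
  have S: "state M t (restrict \<omega> {0..<Suc t}) = state M t \<omega>" "state M t ((restrict \<omega> {0..<t})(t := x)) = state M t \<omega>" for \<omega> x
    by (auto simp: state_def split: nat.split)
  have E: "(restrict \<omega> {0..<Suc t}) t = \<omega> t" "((restrict \<omega> {0..<t})(t := x)) t = x" for \<omega> and x :: "'a \<times> real \<times> 's"
    by auto
  have "(\<integral>\<^sup>+\<omega>. F \<omega> * G (state M t \<omega>) (\<omega> t) \<partial>traj_law M \<theta> \<mu>) =
     (\<integral>\<^sup>+\<omega>. \<integral>\<^sup>+x. F \<omega> * G (state M t \<omega>) x \<partial>step_kernel M \<theta> \<mu> t (restrict \<omega> {0..<t}) \<partial>traj_law M \<theta> \<mu>)"
    using nn_integral_lim_Suc[of "\<lambda>h. F h * G (state M t h) (h t)" t] unfolding traj_law_def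
    by (simp only: F' S E) simp
  also have "\<dots> = (\<integral>\<^sup>+\<omega>. F \<omega> * (\<integral>\<^sup>+x. G (state M t \<omega>) x \<partial>step_kernel M \<theta> \<mu> t (restrict \<omega> {0..<t})) \<partial>traj_law M \<theta> \<mu>)"
    using G by (intro nn_integral_cong nn_integral_cmult)
      (auto simp: measurable_cong_sets[OF sets_P refl] space_PiM)
  finally show ?thesis
    by (simp add: nn_integral_step_kernel[OF M G])
qed

section \<open>Hellinger affinity\<close>

text \<open>Factor of the likelihood contributed by one step; \<open>log_ratio\<close> is the
  logarithm of a quotient of two such factors.\<close>

definition outcome_dens :: "('s, 'a, 'p) pmdp \<Rightarrow> 'p \<Rightarrow> 's \<Rightarrow> 'a \<Rightarrow> real \<times> 's \<Rightarrow> real" where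
  "outcome_dens M \<theta> s a = (\<lambda>(x, s'). rdens M \<theta> s a x * pmf (tprob M \<theta> s a) s')"

text \<open>The quotient is 0 where the density for \<open>\<theta>\<close> vanishes, which is a null set under
  \<open>outcome_law M \<theta> s a\<close>.\<close>

definition affinity :: "('s, 'a, 'p) pmdp \<Rightarrow> 'p \<Rightarrow> 'p \<Rightarrow> 's \<Rightarrow> 'a \<Rightarrow> ennreal" where
  "affinity M \<theta> \<gamma> s a =
     (\<integral>\<^sup>+z. ennreal (sqrt (outcome_dens M \<gamma> s a z / outcome_dens M \<theta> s a z)) \<partial>outcome_law M \<theta> s a)"

lemma outcome_dens_nonneg:
  "param_mdp M \<Longrightarrow> 0 \<le> outcome_dens M \<theta> s a z"
  by (auto simp: outcome_dens_def param_mdp_def split: prod.split)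

lemma measurable_outcome_dens:
  fixes M :: "('s::finite, 'a::finite, 'p::finite) pmdp"
  assumes "param_mdp M"
  shows "outcome_dens M \<theta> s a \<in> borel_measurable (borel \<Otimes>\<^sub>M count_space UNIV)"
proof -
  have [measurable]: "rdens M \<theta> s a \<in> borel_measurable borel"
    using assms by (auto simp: param_mdp_def)
  show ?thesis
    unfolding outcome_dens_def by measurable
qed

lemma nn_integral_outcome_law:
  assumes M: "param_mdp M" and f: "f \<in> borel_measurable (borel \<Otimes>\<^sub>M count_space UNIV)"
  shows "(\<integral>\<^sup>+z. f z \<partial>outcome_law M \<theta> s a) =
    (\<integral>\<^sup>+x. \<integral>\<^sup>+s'. f (x, s') \<partial>measure_pmf (tprob M \<theta> s a) \<partial>reward_law M \<theta> s a)"
proof -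
  have "sets (reward_law M \<theta> s a \<Otimes>\<^sub>M measure_pmf (tprob M \<theta> s a)) = sets (borel \<Otimes>\<^sub>M count_space UNIV)"
    using sets_outcome_law[OF M] by (simp add: outcome_law_def)
  then have "f \<in> borel_measurable (reward_law M \<theta> s a \<Otimes>\<^sub>M measure_pmf (tprob M \<theta> s a))"
    using f by (simp cong: measurable_cong_sets)
  from measure_pmf.nn_integral_fst[OF this] show ?thesis
    by (simp add: outcome_law_def)
qed

text \<open>A density is positive almost everywhere under its own law. This makes the convention
  \<open>x / 0 = 0\<close> harmless in the likelihood ratios.\<close>

lemma AE_outcome_dens_pos:
  fixes M :: "('s::finite, 'a::finite, 'p::finite) pmdp"
  assumes M: "param_mdp M"
  shows "AE z in outcome_law M \<theta> s a. 0 < outcome_dens M \<theta> s a z"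
proof -
  interpret A: prob_space "reward_law M \<theta> s a" using M by (auto simp: param_mdp_def)
  interpret pair_sigma_finite "reward_law M \<theta> s a" "measure_pmf (tprob M \<theta> s a)" ..
  have base: "sets (base M) = sets borel" using M by (auto simp: param_mdp_def)
  have "rdens M \<theta> s a \<in> borel_measurable borel" using M by (auto simp: param_mdp_def)
  then have [measurable]: "rdens M \<theta> s a \<in> borel_measurable (base M)"
    by (simp cong: measurable_cong_sets add: base)
  have [measurable]: "outcome_dens M \<theta> s a \<in> borel_measurable (reward_law M \<theta> s a \<Otimes>\<^sub>M measure_pmf (tprob M \<theta> s a))"
    using measurable_outcome_dens[OF M, of \<theta> s a] sets_outcome_law[OF M, of \<theta> s a]
    by (simp add: outcome_law_def cong: measurable_cong_sets)
  show ?thesis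
    unfolding outcome_law_def
  proof (rule AE_pair_measure)
    have "AE x in reward_law M \<theta> s a. 0 < rdens M \<theta> s a x"
      unfolding reward_law_def by (subst AE_density) auto
    then show "AE x in reward_law M \<theta> s a. AE y in measure_pmf (tprob M \<theta> s a). 0 < outcome_dens M \<theta> s a (x, y)"
      by eventually_elim (auto simp: AE_measure_pmf_iff outcome_dens_def pmf_positive)
  qed measurable
qed

text \<open>Change of measure: the density of \<theta> cancels and at most the total mass of the law
  of \<gamma> remains. The form is an inequality because the quotient is 0 where the density of
  \<theta> vanishes.\<close>

lemma nn_integral_outcome_dens_ratio_le:
  fixes M :: "('s::finite, 'a::finite, 'p::finite) pmdp"
  assumes M: "param_mdp M"
  shows "(\<integral>\<^sup>+z. ennreal (outcome_dens M \<gamma> s a z / outcome_dens M \<theta> s a z) \<partial>outcome_law M \<theta> s a) \<le> 1"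
proof -
  note [measurable] = measurable_outcome_dens[OF M]
  have base: "sets (base M) = sets borel" using M by (auto simp: param_mdp_def)
  have q: "rdens M \<theta> s a \<in> borel_measurable borel" "\<And>x. 0 \<le> rdens M \<theta> s a x" for \<theta>
    using M by (auto simp: param_mdp_def)
  have [measurable]: "rdens M \<theta> s a \<in> borel_measurable (base M)" for \<theta>
    using q(1) by (simp cong: measurable_cong_sets add: base)
  have pmf: "(\<integral>\<^sup>+s'. ennreal (outcome_dens M \<gamma> s a (x, s') / outcome_dens M \<theta> s a (x, s')) \<partial>measure_pmf (tprob M \<theta> s a))
      \<le> ennreal (rdens M \<gamma> s a x / rdens M \<theta> s a x)" for x
  proof -
    have "(\<integral>\<^sup>+s'. ennreal (outcome_dens M \<gamma> s a (x, s') / outcome_dens M \<theta> s a (x, s')) \<partial>measure_pmf (tprob M \<theta> s a))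
      = (\<Sum>s'\<in>UNIV. ennreal (outcome_dens M \<gamma> s a (x, s') / outcome_dens M \<theta> s a (x, s')) * ennreal (pmf (tprob M \<theta> s a) s'))"
      by (rule nn_integral_measure_pmf_support) auto
    also have "\<dots> \<le> (\<Sum>s'\<in>UNIV. ennreal (rdens M \<gamma> s a x / rdens M \<theta> s a x * pmf (tprob M \<gamma> s a) s'))"
    proof (intro sum_mono)
      fix s'
      \<comment> \<open>The transition probability under \<theta> cancels if it is positive;
        otherwise the left side is 0.\<close>
      have "outcome_dens M \<gamma> s a (x, s') / outcome_dens M \<theta> s a (x, s') * pmf (tprob M \<theta> s a) s'
          \<le> rdens M \<gamma> s a x / rdens M \<theta> s a x * pmf (tprob M \<gamma> s a) s'"
        by (cases "pmf (tprob M \<theta> s a) s' = 0") (simp_all add: outcome_dens_def q(2))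
      then show "ennreal (outcome_dens M \<gamma> s a (x, s') / outcome_dens M \<theta> s a (x, s')) * ennreal (pmf (tprob M \<theta> s a) s')
          \<le> ennreal (rdens M \<gamma> s a x / rdens M \<theta> s a x * pmf (tprob M \<gamma> s a) s')"
        by (simp add: ennreal_mult''[symmetric] ennreal_leI)
    qed
    also have "\<dots> = ennreal (rdens M \<gamma> s a x / rdens M \<theta> s a x)"
      by (subst sum_ennreal) (simp_all only: sum_distrib_left[symmetric] sum_pmf_eq_1[OF finite subset_UNIV], auto simp: q(2))
    finally show ?thesis .
  qed
  have "(\<integral>\<^sup>+z. ennreal (outcome_dens M \<gamma> s a z / outcome_dens M \<theta> s a z) \<partial>outcome_law M \<theta> s a)
     \<le> (\<integral>\<^sup>+x. ennreal (rdens M \<gamma> s a x / rdens M \<theta> s a x) \<partial>reward_law M \<theta> s a)"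
    by (subst nn_integral_outcome_law[OF M]) (measurable, intro nn_integral_mono pmf)
  also have "\<dots> = (\<integral>\<^sup>+x. ennreal (rdens M \<theta> s a x) * ennreal (rdens M \<gamma> s a x / rdens M \<theta> s a x) \<partial>base M)"
    unfolding reward_law_def by (rule nn_integral_density) auto
  also have "\<dots> \<le> (\<integral>\<^sup>+x. ennreal (rdens M \<gamma> s a x) \<partial>base M)"
    by (intro nn_integral_mono, subst ennreal_mult'[symmetric]) (auto simp: q(2) intro!: ennreal_leI)
  also have "\<dots> = emeasure (reward_law M \<gamma> s a) (space (reward_law M \<gamma> s a))"
    unfolding reward_law_def by (subst emeasure_density) (auto intro!: nn_integral_cong)
  also have "\<dots> = 1"
    using M by (intro prob_space.emeasure_space_1) (auto simp: param_mdp_def)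
  finally show ?thesis .
qed

text \<open>With \<open>w\<close> the root of the density ratio,
  \<open>w + (1 - w)\<^sup>2 / 2 = 1/2 + w\<^sup>2 / 2\<close>, and \<open>w\<^sup>2\<close> has
  mean at most 1. Keeping the square as a defect term gives access to the case of equality in
  \<open>affinity \<le> 1\<close>.\<close>

lemma affinity_plus_defect_le:
  fixes M :: "('s::finite, 'a::finite, 'p::finite) pmdp"
  assumes M: "param_mdp M"
  shows "affinity M \<theta> \<gamma> s a +
    (\<integral>\<^sup>+z. ennreal ((1 - sqrt (outcome_dens M \<gamma> s a z / outcome_dens M \<theta> s a z))\<^sup>2 / 2) \<partial>outcome_law M \<theta> s a) \<le> 1"
proof -
  let ?r = "\<lambda>z. outcome_dens M \<gamma> s a z / outcome_dens M \<theta> s a z"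
  note [measurable] = measurable_outcome_dens[OF M]
  have [measurable_cong]: "sets (outcome_law M \<theta> s a) = sets (borel \<Otimes>\<^sub>M count_space UNIV)"
    by (rule sets_outcome_law[OF M])
  interpret prob_space "outcome_law M \<theta> s a" by (rule prob_space_outcome_law[OF M])
  have r: "0 \<le> ?r z" for z
    by (intro divide_nonneg_nonneg outcome_dens_nonneg M)
  have "affinity M \<theta> \<gamma> s a + (\<integral>\<^sup>+z. ennreal ((1 - sqrt (?r z))\<^sup>2 / 2) \<partial>outcome_law M \<theta> s a)
     = (\<integral>\<^sup>+z. ennreal (sqrt (?r z)) + ennreal ((1 - sqrt (?r z))\<^sup>2 / 2) \<partial>outcome_law M \<theta> s a)"
    unfolding affinity_def by (subst nn_integral_add) auto
  also have "\<dots> = (\<integral>\<^sup>+z. ennreal (1/2) + ennreal (1/2) * ennreal (?r z) \<partial>outcome_law M \<theta> s a)"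
  proof (intro nn_integral_cong)
    fix z
    define w where "w = sqrt (?r z)"
    have w: "0 \<le> w" "?r z = w\<^sup>2"
      using r[of z] by (simp_all add: w_def)
    have "w + (1 - w)\<^sup>2 / 2 = 1/2 + 1/2 * w\<^sup>2"
      by (simp add: power2_eq_square field_simps)
    then have "ennreal w + ennreal ((1 - w)\<^sup>2 / 2) = ennreal (1/2) + ennreal (1/2) * ennreal (w\<^sup>2)"
      using w(1) ennreal_plus[of w "(1 - w)\<^sup>2 / 2"] ennreal_plus[of "1/2" "1/2 * w\<^sup>2"] ennreal_mult'[of "1/2" "w\<^sup>2"]
      by (simp del: ennreal_plus)
    then show "ennreal (sqrt (?r z)) + ennreal ((1 - sqrt (?r z))\<^sup>2 / 2) = ennreal (1/2) + ennreal (1/2) * ennreal (?r z)"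
      using w by simp
  qed
  also have "\<dots> = ennreal (1/2) + ennreal (1/2) * (\<integral>\<^sup>+z. ennreal (?r z) \<partial>outcome_law M \<theta> s a)"
    by (simp add: nn_integral_add nn_integral_cmult emeasure_space_1)
  also have "\<dots> \<le> ennreal (1/2) + ennreal (1/2) * 1"
    by (intro add_left_mono mult_left_mono nn_integral_outcome_dens_ratio_le M) simp
  also have "\<dots> = ennreal (1/2 + 1/2)"
    by (subst ennreal_plus) auto
  also have "\<dots> = 1"
    by simp
  finally show ?thesis .
qed

lemma affinity_le_1:
  fixes M :: "('s::finite, 'a::finite, 'p::finite) pmdp"
  assumes "param_mdp M"
  shows "affinity M \<theta> \<gamma> s a \<le> 1"
  using affinity_plus_defect_le[OF assms, of \<theta> \<gamma> s a] by (rule order.trans[rotated]) simp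

text \<open>If the affinity were 1, the defect would vanish, so the density ratio would be 1 and the
  log ratio 0 almost everywhere, and the divergence would be 0.\<close>

lemma affinity_less_1:
  fixes M :: "('s::finite, 'a::finite, 'p::finite) pmdp"
  assumes M: "param_mdp M" and kl: "kl M \<theta> \<gamma> s a \<noteq> 0"
  shows "affinity M \<theta> \<gamma> s a < 1"
proof (rule ccontr)
  let ?r = "\<lambda>z. outcome_dens M \<gamma> s a z / outcome_dens M \<theta> s a z"
  let ?D = "\<integral>\<^sup>+z. ennreal ((1 - sqrt (?r z))\<^sup>2 / 2) \<partial>outcome_law M \<theta> s a"
  note [measurable] = measurable_outcome_dens[OF M]
  have [measurable_cong]: "sets (outcome_law M \<theta> s a) = sets (borel \<Otimes>\<^sub>M count_space UNIV)"
    by (rule sets_outcome_law[OF M])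
  assume "\<not> affinity M \<theta> \<gamma> s a < 1"
  then have "affinity M \<theta> \<gamma> s a = 1"
    using affinity_le_1[OF M, of \<theta> \<gamma> s a] by simp
  then have "?D = 0"
    using affinity_plus_defect_le[OF M, of \<theta> \<gamma> s a] ennreal_add_left_cancel_le[of 1 ?D 0] by simp
  then have "AE z in outcome_law M \<theta> s a. ennreal ((1 - sqrt (?r z))\<^sup>2 / 2) = 0"
    by (subst (asm) nn_integral_0_iff_AE) measurable
  then have "AE z in outcome_law M \<theta> s a. log_ratio M \<theta> \<gamma> s a z = 0"
  proof eventually_elim
    case (elim z)
    then have "(1 - sqrt (?r z))\<^sup>2 \<le> 0"
      by (simp add: ennreal_eq_0_iff)
    then have "?r z = 1"
      by simp
    then show ?case
      by (simp add: log_ratio_def outcome_dens_def split: prod.splits)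
  qed
  then have "kl M \<theta> \<gamma> s a = 0"
    unfolding kl_def by (rule integral_eq_zero_AE)
  with kl show False by contradiction
qed

section \<open>Visits of a finite chain\<close>

text \<open>The mean of \<open>r ^ N\<close> for the number \<open>N\<close> of visits to \<open>s\<close> at the times \<open>0, \<dots>, n - 1\<close>, for the
  chain started in \<open>x\<close>.\<close>

primrec visit_transform :: "('s::finite \<Rightarrow> 's pmf) \<Rightarrow> 's \<Rightarrow> real \<Rightarrow> nat \<Rightarrow> 's \<Rightarrow> real" where
  "visit_transform K s r 0 x = 1"
| "visit_transform K s r (Suc n) x = (if x = s then r else 1) * (\<Sum>y\<in>UNIV. pmf (K x) y * visit_transform K s r n y)"

lemma visit_transform_nonneg: "0 \<le> r \<Longrightarrow> 0 \<le> visit_transform K s r n x"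
  by (induction n arbitrary: x) (auto intro!: sum_nonneg mult_nonneg_nonneg)

text \<open>A longer horizon can only add visits, each of which multiplies by
  \<open>r \<le> 1\<close>.\<close>

lemma visit_transform_Suc_le:
  assumes "0 \<le> r" "r \<le> 1"
  shows "visit_transform K s r (Suc n) x \<le> visit_transform K s r n x"
proof (induction n arbitrary: x)
  case 0
  then show ?case using assms by (simp add: sum_pmf_eq_1)
next
  case (Suc n)
  have "(\<Sum>y\<in>UNIV. pmf (K x) y * visit_transform K s r (Suc n) y) \<le> (\<Sum>y\<in>UNIV. pmf (K x) y * visit_transform K s r n y)"
    by (intro sum_mono mult_left_mono Suc.IH pmf_nonneg)
  then show ?case
    using assms by (subst (1 2) visit_transform.simps(2)) (auto intro: mult_left_mono)
qed

lemma antimono_visit_transform: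
  assumes "0 \<le> r" "r \<le> 1" "m \<le> n"
  shows "visit_transform K s r n x \<le> visit_transform K s r m x"
  using visit_transform_Suc_le[OF assms(1,2)] assms(3)
  by (rule lift_Suc_antimono_le)

text \<open>Markov property at time \<open>n\<close>: wherever the chain is then, the remaining
  \<open>m\<close> steps contribute a factor of conditional mean at most \<kappa>.\<close>

lemma visit_transform_add_le:
  assumes "0 \<le> r" "\<And>y. visit_transform K s r m y \<le> \<kappa>"
  shows "visit_transform K s r (n + m) x \<le> \<kappa> * visit_transform K s r n x"
proof (induction n arbitrary: x)
  case 0
  then show ?case using assms by simp
next
  case (Suc n)
  have "visit_transform K s r (Suc n + m) x \<le> (if x = s then r else 1) * (\<Sum>y\<in>UNIV. pmf (K x) y * (\<kappa> * visit_transform K s r n y))"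
    using assms(1) by (auto intro!: mult_left_mono sum_mono Suc.IH)
  also have "\<dots> = \<kappa> * visit_transform K s r (Suc n) x"
    by (simp add: sum_distrib_left mult_ac)
  finally show ?case .
qed

text \<open>The chain is in \<open>s\<close> at time \<open>n\<close> with positive probability, and
  horizon \<open>Suc n\<close> still counts time \<open>n\<close>. So the transform averages values
  at most 1, some of them at most \<open>r\<close>.\<close>

lemma visit_transform_less_1:
  assumes r: "0 \<le> r" "r < 1" and "0 < pmf (n_step K n x) s"
  shows "visit_transform K s r (Suc n) x < 1"
  using assms(3)
proof (induction n arbitrary: x)
  case 0
  then show ?case using r by (auto simp: sum_pmf_eq_1 indicator_def split: if_splits)
next
  case (Suc n)
  have le1: "visit_transform K s r m y \<le> 1" for m y
    using antimono_visit_transform[of r 0 m K s y] r by simp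
  from Suc.prems have "s \<in> set_pmf (n_step K (Suc n) x)"
    by (simp only: pmf_positive_iff)
  then obtain z where z: "z \<in> set_pmf (K x)" "s \<in> set_pmf (n_step K n z)"
    by auto
  then have lt: "visit_transform K s r (Suc n) z < 1"
    by (intro Suc.IH) (simp add: pmf_positive_iff)
  \<comment> \<open>One strict term is enough: the successor \<open>z\<close> has positive weight
    and leads to \<open>s\<close> in \<open>n\<close> steps.\<close>
  have "(\<Sum>y\<in>UNIV. pmf (K x) y * visit_transform K s r (Suc n) y) < (\<Sum>y\<in>UNIV. pmf (K x) y * 1)"
  proof (rule sum_strict_mono_ex1)
    show "\<exists>y\<in>UNIV. pmf (K x) y * visit_transform K s r (Suc n) y < pmf (K x) y * 1"
      using z(1) lt by (intro bexI[of _ z] mult_strict_left_mono) (auto simp: pmf_positive)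
  qed (use le1 in \<open>auto intro!: mult_left_le simp del: visit_transform.simps\<close>)
  also have "\<dots> = 1" by (simp add: sum_pmf_eq_1)
  finally have *: "(\<Sum>y\<in>UNIV. pmf (K x) y * visit_transform K s r (Suc n) y) < 1" .
  have "visit_transform K s r (Suc (Suc n)) x \<le> (\<Sum>y\<in>UNIV. pmf (K x) y * visit_transform K s r (Suc n) y)"
    using r by (subst visit_transform.simps(2)) (auto intro!: mult_left_le_one_le sum_nonneg mult_nonneg_nonneg visit_transform_nonneg simp del: visit_transform.simps)
  with * show ?case by simp
qed

text \<open>By finiteness there is one block length \<open>m\<close> that lets every starting state
  reach \<open>s\<close>; each block then contributes a factor at most \<kappa> < 1.\<close>

lemma visit_transform_exponential_decay:
  assumes r: "0 < r" "r < 1" and acc: "\<And>x. accessible K x s"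
  shows "\<exists>A>0. \<exists>b>0. \<forall>t x. visit_transform K s r t x \<le> A * exp (- b * real t)"
proof -
  have "\<forall>x. \<exists>n. 0 < pmf (n_step K n x) s"
    using acc by (simp add: accessible_def)
  then obtain n where n: "\<And>x. 0 < pmf (n_step K (n x) x) s"
    by metis
  \<comment> \<open>Horizon \<open>m\<close> counts the times up to \<open>m - 1\<close>, hence the
    \<open>Suc\<close>.\<close>
  define m where "m = Suc (Max (range n))"
  \<comment> \<open>The inserted 1/2 makes \<kappa> visibly positive, as \<open>ln \<kappa>\<close>
    and \<open>1 / \<kappa>\<close> require.\<close>
  define \<kappa> where "\<kappa> = Max (insert (1/2) (range (visit_transform K s r m)))"
  have "visit_transform K s r m x < 1" for x
  proof -
    have "visit_transform K s r m x \<le> visit_transform K s r (Suc (n x)) x"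
      using r by (intro antimono_visit_transform) (auto simp: m_def)
    also have "\<dots> < 1" using r n by (intro visit_transform_less_1) auto
    finally show ?thesis .
  qed
  then have \<kappa>1: "\<kappa> < 1" unfolding \<kappa>_def by (subst Max_less_iff) auto
  have "1/2 \<le> \<kappa>" unfolding \<kappa>_def by (intro Max_ge) auto
  then have \<kappa>0: "0 < \<kappa>" by simp
  have \<kappa>: "visit_transform K s r m x \<le> \<kappa>" for x unfolding \<kappa>_def by (intro Max_ge) auto
  have pow: "visit_transform K s r (k * m) x \<le> \<kappa> ^ k" for k x
  proof (induction k)
    case (Suc k)
    have "visit_transform K s r (k * m + m) x \<le> \<kappa> * visit_transform K s r (k * m) x"
      using r \<kappa> by (intro visit_transform_add_le) auto
    also have "\<dots> \<le> \<kappa> * \<kappa> ^ k" using \<kappa>0 Suc.IH by (intro mult_left_mono) auto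
    finally show ?case by (simp add: add.commute)
  qed simp
  have m0: "0 < m" by (simp add: m_def)
  define b where "b = - ln \<kappa> / m"
  have b: "0 < b" using \<kappa>0 \<kappa>1 m0 by (simp add: b_def field_simps)
  have "visit_transform K s r t x \<le> (1 / \<kappa>) * exp (- b * real t)" for t x
  proof -
    have "visit_transform K s r t x \<le> visit_transform K s r (t div m * m) x"
      using r by (intro antimono_visit_transform) auto
    also have "\<dots> \<le> \<kappa> ^ (t div m)" by (rule pow)
    also have "\<dots> = exp (ln \<kappa> * real (t div m))"
      using \<kappa>0 by (simp add: exp_of_nat2_mult)
    \<comment> \<open>Rounding \<open>t\<close> down to full blocks loses less than one block; this
      is the source of the constant \<open>1 / \<kappa>\<close>.\<close>
    also have "\<dots> \<le> exp (ln \<kappa> * (real t / real m - 1))"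
    proof -
      have "real t / real m - 1 \<le> real (t div m)"
        using dividend_less_div_times[OF m0, of t] m0
        by (simp add: field_simps flip: of_nat_mult of_nat_add)
      then show ?thesis using \<kappa>0 \<kappa>1 by (simp add: mult_left_mono_neg)
    qed
    also have "\<dots> = (1 / \<kappa>) * exp (- b * real t)"
      using \<kappa>0 by (simp add: b_def algebra_simps exp_diff)
    finally show ?thesis .
  qed
  with b \<kappa>0 show ?thesis
    by (intro exI[of _ "1/\<kappa>"] exI[of _ b] conjI) auto
qed

section \<open>Functionals of the trajectory\<close>

lemma measurable_path_prod:
  fixes M :: "('s::finite, 'a::finite, 'p) pmdp"
  assumes G: "\<And>s. G s \<in> borel_measurable step_space" and J: "{0..<t} \<subseteq> J"
  shows "(\<lambda>\<omega>. \<Prod>i<t. G (state M i \<omega>) (\<omega> i) :: ennreal) \<in> borel_measurable (PiM J (\<lambda>_. step_space))"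
proof (intro borel_measurable_prod_ennreal)
  fix i assume "i \<in> {..<t}"
  then have i: "i \<in> J" "J \<supseteq> {0..<i}" using J by auto
  have c: "(\<lambda>\<omega>. \<omega> i) \<in> PiM J (\<lambda>_. step_space :: ('a \<times> real \<times> 's) measure) \<rightarrow>\<^sub>M step_space"
    using i by (intro measurable_component_singleton)
  show "(\<lambda>\<omega>. G (state M i \<omega>) (\<omega> i)) \<in> borel_measurable (PiM J (\<lambda>_. step_space))"
    by (rule measurable_compose_countable'[where I=UNIV, OF measurable_compose[OF c G] measurable_state[OF i(2)]]) simp
qed

lemma path_prod_restrict:
  "(\<Prod>i<t. G (state M i (restrict \<omega> {0..<t})) (restrict \<omega> {0..<t} i)) = (\<Prod>i<t. G (state M i \<omega>) (\<omega> i))"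
  by (intro prod.cong refl) (auto simp: state_def split: nat.split)

lemma restrict_in_history_space[simp]: "restrict \<omega> {0..<t} \<in> space (history_space t)"
  by (auto simp: space_PiM)

text \<open>Supermartingale bound: each new factor has conditional mean at most 1, so by the tower
  property the mean of the product never exceeds 1. The condition concerns only actions in the
  support of the policy, which for candidate policies are the actions prescribed by
  \<open>f\<close>.\<close>

lemma nn_integral_path_prod_le_1:
  fixes M :: "('s::finite, 'a::finite, 'p::finite) pmdp"
  assumes M: "param_mdp M" and mu: "\<mu> \<in> policies"
    and G: "\<And>s. G s \<in> borel_measurable step_space"
    and le: "\<And>t h a. h \<in> space (history_space t) \<Longrightarrow> a \<in> set_pmf (\<mu> t h) \<Longrightarrow>
       (\<integral>\<^sup>+y. G (state M t h) (a, y) \<partial>outcome_law M \<theta> (state M t h) a) \<le> 1"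
  shows "(\<integral>\<^sup>+\<omega>. (\<Prod>i<t. G (state M i \<omega>) (\<omega> i)) \<partial>traj_law M \<theta> \<mu>) \<le> 1"
proof (induction t)
  case 0
  interpret prob_space "traj_law M \<theta> \<mu>" by (rule prob_space_traj_law[OF M mu])
  show ?case by (simp add: emeasure_space_1)
next
  case (Suc t)
  let ?W = "\<lambda>\<omega>. \<Prod>i<t. G (state M i \<omega>) (\<omega> i)"
  have "(\<integral>\<^sup>+\<omega>. (\<Prod>i<Suc t. G (state M i \<omega>) (\<omega> i)) \<partial>traj_law M \<theta> \<mu>)
      = (\<integral>\<^sup>+\<omega>. ?W \<omega> * (\<integral>\<^sup>+a. \<integral>\<^sup>+y. G (state M t \<omega>) (a, y) \<partial>outcome_law M \<theta> (state M t \<omega>) a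
      \<partial>measure_pmf (\<mu> t (restrict \<omega> {0..<t}))) \<partial>traj_law M \<theta> \<mu>)"
    unfolding prod.lessThan_Suc
    by (intro nn_integral_traj_law_step M mu measurable_path_prod G path_prod_restrict) auto
  also have "\<dots> \<le> (\<integral>\<^sup>+\<omega>. ?W \<omega> * (\<integral>\<^sup>+a. 1 \<partial>measure_pmf (\<mu> t (restrict \<omega> {0..<t}))) \<partial>traj_law M \<theta> \<mu>)"
    using le[OF restrict_in_history_space]
    by (intro nn_integral_mono mult_left_mono nn_integral_mono_AE) (auto simp: AE_measure_pmf_iff)
  also have "\<dots> = (\<integral>\<^sup>+\<omega>. ?W \<omega> \<partial>traj_law M \<theta> \<mu>)"
    by simp
  finally show ?case using Suc.IH by simp
qed

section \<open>Visit counts\<close>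

lemma visits_Suc: "visits M s (Suc t) \<omega> = visits M s t \<omega> + (if state M t \<omega> = s then 1 else 0)"
proof -
  have "{i. i < Suc t \<and> state M i \<omega> = s} = {i. i < t \<and> state M i \<omega> = s} \<union> (if state M t \<omega> = s then {t} else {})"
    by (auto simp: less_Suc_eq)
  then show ?thesis by (simp add: visits_def)
qed

text \<open>Makes powers of visit counts an instance of path products, so that measurability and
  dependence on the history alone carry over.\<close>

lemma prod_visits:
  "(\<Prod>i<t. if state M i \<omega> = s then c else 1) = (c :: 'b::comm_monoid_mult) ^ visits M s t \<omega>"
  by (induction t) (simp_all add: visits_Suc mult.commute, simp add: visits_def)

lemma measurable_power_visits:
  fixes M :: "('s::finite, 'a::finite, 'p) pmdp"
  assumes "{0..<t} \<subseteq> J"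
  shows "(\<lambda>\<omega>. (c :: ennreal) ^ visits M s t \<omega>) \<in> borel_measurable (PiM J (\<lambda>_. step_space :: ('a \<times> real \<times> 's) measure))"
  using measurable_path_prod[where G="\<lambda>s' _. if s' = s then c else 1" and M=M and t=t and J=J] assms
  by (simp add: prod_visits)

lemma stationary_in_policies: "stationary M f \<in> policies"
  unfolding policies_def stationary_def
proof (intro CollectI allI)
  fix t
  have "(\<lambda>s. measure_pmf (return_pmf (f s))) \<in> count_space UNIV \<rightarrow>\<^sub>M subprob_algebra (count_space UNIV)"
    by (auto simp: space_subprob_algebra intro!: prob_space_imp_subprob_space measure_pmf.prob_space_axioms)
  from measurable_compose[OF measurable_state[OF order.refl] this]
  show "(\<lambda>h. measure_pmf (return_pmf (f (state M t h)))) \<in> history_space t \<rightarrow>\<^sub>M subprob_algebra (count_space UNIV)" .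
qed

lemma nn_integral_outcome_law_state:
  fixes M :: "('s::finite, 'a::finite, 'p::finite) pmdp"
  assumes M: "param_mdp M" and u: "\<And>x. 0 \<le> u x"
  shows "(\<integral>\<^sup>+y. ennreal (u (snd y)) \<partial>outcome_law M \<theta> s a) = ennreal (\<Sum>x\<in>UNIV. pmf (tprob M \<theta> s a) x * u x)"
proof -
  interpret prob_space "reward_law M \<theta> s a" using M by (auto simp: param_mdp_def)
  have "(\<integral>\<^sup>+y. ennreal (u (snd y)) \<partial>outcome_law M \<theta> s a) = (\<integral>\<^sup>+x. ennreal (u x) \<partial>measure_pmf (tprob M \<theta> s a))"
    by (subst nn_integral_outcome_law[OF M]) (simp_all add: emeasure_space_1)
  also have "\<dots> = (\<Sum>x\<in>UNIV. ennreal (u x) * ennreal (pmf (tprob M \<theta> s a) x))"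
    by (rule nn_integral_measure_pmf_support) auto
  also have "\<dots> = ennreal (\<Sum>x\<in>UNIV. pmf (tprob M \<theta> s a) x * u x)"
    by (subst sum_ennreal[symmetric]) (auto simp: u ennreal_mult mult.commute)
  finally show ?thesis .
qed

text \<open>The integral depends on \<open>t + k\<close> only: by the Markov property the last
  elapsed step can be moved into the remaining horizon. Case \<open>k = 0\<close> is the wanted mean
  and \<open>t = 0\<close> its value; the general \<open>k\<close> is what the induction on
  \<open>t\<close> needs.\<close>

lemma nn_integral_visits_stationary:
  fixes M :: "('s::finite, 'a::finite, 'p::finite) pmdp" and f :: "'s \<Rightarrow> 'a" and \<theta> :: 'p
  assumes M: "param_mdp M" and r: "0 \<le> r"
  defines "K \<equiv> \<lambda>s. tprob M \<theta> s (f s)"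
  shows "(\<integral>\<^sup>+\<omega>. ennreal r ^ visits M s t \<omega> * ennreal (visit_transform K s r k (state M t \<omega>))
      \<partial>traj_law M \<theta> (stationary M f)) = ennreal (visit_transform K s r (t + k) (start M))"
proof (induction t arbitrary: k)
  case 0
  interpret prob_space "traj_law M \<theta> (stationary M f)"
    by (rule prob_space_traj_law[OF M stationary_in_policies])
  show ?case by (simp add: visits_def state_def emeasure_space_1)
next
  case (Suc t)
  let ?u = "visit_transform K s r"
  let ?w = "\<lambda>s'. if s' = s then ennreal r else 1"
  let ?G = "\<lambda>s' z. ?w s' * ennreal (?u k (snd (snd z)))"
  have "(\<integral>\<^sup>+\<omega>. ennreal r ^ visits M s (Suc t) \<omega> * ennreal (?u k (state M (Suc t) \<omega>)) \<partial>traj_law M \<theta> (stationary M f))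
    = (\<integral>\<^sup>+\<omega>. ennreal r ^ visits M s t \<omega> * ?G (state M t \<omega>) (\<omega> t) \<partial>traj_law M \<theta> (stationary M f))"
    by (intro nn_integral_cong) (simp add: visits_Suc state_def mult_ac)
  also have "\<dots> = (\<integral>\<^sup>+\<omega>. ennreal r ^ visits M s t \<omega> *
      (\<integral>\<^sup>+a. \<integral>\<^sup>+y. ?G (state M t \<omega>) (a, y) \<partial>outcome_law M \<theta> (state M t \<omega>) a
      \<partial>measure_pmf (stationary M f t (restrict \<omega> {0..<t}))) \<partial>traj_law M \<theta> (stationary M f))"
  proof (intro nn_integral_traj_law_step M stationary_in_policies measurable_power_visits order.refl)
    show "ennreal r ^ visits M s t (restrict \<omega> {0..<t}) = ennreal r ^ visits M s t \<omega>" for \<omega>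
      using path_prod_restrict[of "\<lambda>s' _. if s' = s then ennreal r else 1" M \<omega> t] by (simp add: prod_visits)
  qed measurable
  also have "\<dots> = (\<integral>\<^sup>+\<omega>. ennreal r ^ visits M s t \<omega> * ennreal (?u (Suc k) (state M t \<omega>)) \<partial>traj_law M \<theta> (stationary M f))"
  proof (intro nn_integral_cong arg_cong2[where f="(*)"] refl)
    fix \<omega>
    let ?s = "state M t \<omega>"
    have "(\<lambda>y. ennreal (?u k (snd y))) \<in> borel_measurable (outcome_law M \<theta> ?s (f ?s))"
      by (subst measurable_cong_sets[OF sets_outcome_law[OF M] refl]) measurable
    then have "(\<integral>\<^sup>+y. ?G ?s (f ?s, y) \<partial>outcome_law M \<theta> ?s (f ?s)) = ?w ?s * ennreal (\<Sum>x\<in>UNIV. pmf (K ?s) x * ?u k x)"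
      by (simp add: nn_integral_cmult nn_integral_outcome_law_state[OF M] visit_transform_nonneg r K_def)
    also have "\<dots> = ennreal (?u (Suc k) ?s)"
      using r by (simp add: ennreal_mult' visit_transform_nonneg sum_nonneg)
    finally show "(\<integral>\<^sup>+a. \<integral>\<^sup>+y. ?G ?s (a, y) \<partial>outcome_law M \<theta> ?s a
      \<partial>measure_pmf (stationary M f t (restrict \<omega> {0..<t}))) = ennreal (?u (Suc k) ?s)"
      by (simp add: stationary_def)
  qed
  also have "\<dots> = ennreal (?u (Suc t + k) (start M))"
    using Suc.IH[of "Suc k"] by simp
  finally show ?case .
qed

text \<open>On the coupling, more visits mean a smaller power pointwise, and each of the two
  integrals sees only its own marginal.\<close>

lemma nn_integral_visits_dominate:
  fixes M :: "('s::finite, 'a::finite, 'p) pmdp"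
  assumes dom: "visits_dominate M \<theta> s \<mu> \<mu>'" and r: "0 \<le> r" "r \<le> 1"
  shows "(\<integral>\<^sup>+\<omega>. ennreal r ^ visits M s t \<omega> \<partial>traj_law M \<theta> \<mu>) \<le> (\<integral>\<^sup>+\<omega>. ennreal r ^ visits M s t \<omega> \<partial>traj_law M \<theta> \<mu>')"
proof -
  from dom obtain Q where Q: "sets Q = sets (traj_space \<Otimes>\<^sub>M traj_space)"
    "distr Q traj_space fst = traj_law M \<theta> \<mu>" "distr Q traj_space snd = traj_law M \<theta> \<mu>'"
    and ae: "AE (\<omega>, \<omega>') in Q. \<forall>t. visits M s t \<omega> \<ge> visits M s t \<omega>'"
    unfolding visits_dominate_def by blast
  note [measurable] = measurable_power_visits[of t UNIV "ennreal r" M s, simplified]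
  have fs: "fst \<in> Q \<rightarrow>\<^sub>M traj_space" "snd \<in> Q \<rightarrow>\<^sub>M traj_space"
    unfolding measurable_cong_sets[OF Q(1) refl] by simp_all
  have "(\<integral>\<^sup>+z. ennreal r ^ visits M s t (fst z) \<partial>Q) \<le> (\<integral>\<^sup>+z. ennreal r ^ visits M s t (snd z) \<partial>Q)"
    using ae r
    by (intro nn_integral_mono_AE) (auto elim!: eventually_mono simp: ennreal_power intro!: ennreal_leI power_decreasing)
  then show ?thesis
    unfolding Q(2,3)[symmetric] by (simp add: nn_integral_distr fs)
qed

section \<open>Likelihoods along a trajectory\<close>

lemma likelihood_eq_prod_outcome_dens:
  "likelihood M \<theta> t \<omega> = (\<Prod>i<t. outcome_dens M \<theta> (state M i \<omega>) (action i \<omega>) (snd (\<omega> i)))"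
  unfolding likelihood_def
  by (intro prod.cong refl) (auto simp: outcome_dens_def rew_def state_def split: prod.split)

text \<open>Given the history and the action, an outcome of zero density has probability 0; there
  are only countably many steps to consider.\<close>

lemma AE_likelihood_pos:
  fixes M :: "('s::finite, 'a::finite, 'p::finite) pmdp"
  assumes M: "param_mdp M" and mu: "\<mu> \<in> policies"
  shows "AE \<omega> in traj_law M \<theta> \<mu>. 0 < likelihood M \<theta> t \<omega>"
proof -
  let ?G = "\<lambda>s z. indicator {z. outcome_dens M \<theta> s (fst z) (snd z) \<le> 0} z :: ennreal"
  note [measurable] = measurable_outcome_dens[OF M]
  have dens[measurable]: "(\<lambda>z. outcome_dens M \<theta> s (fst z) (snd z)) \<in> borel_measurable step_space" for s
    by (rule measurable_compose_countable'[where I=UNIV and g=fst]) auto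
  have G: "?G s \<in> borel_measurable step_space" for s
    by measurable
  have "AE \<omega> in traj_law M \<theta> \<mu>. 0 < outcome_dens M \<theta> (state M i \<omega>) (action i \<omega>) (snd (\<omega> i))" for i
  proof -
    have 0: "(\<integral>\<^sup>+y. ?G s (a, y) \<partial>outcome_law M \<theta> s a) = 0" for s a
    proof -
      have "(\<integral>\<^sup>+y. ?G s (a, y) \<partial>outcome_law M \<theta> s a) = (\<integral>\<^sup>+y. 0 \<partial>outcome_law M \<theta> s a)"
        using AE_outcome_dens_pos[OF M, of \<theta> s a]
        by (intro nn_integral_cong_AE) (auto elim!: eventually_mono simp: indicator_def)
      then show ?thesis by simp
    qed
    \<comment> \<open>The factor 1 is the constant function of the history in the role of
      \<open>F\<close> in the tower property.\<close>
    have "(\<integral>\<^sup>+\<omega>. 1 * ?G (state M i \<omega>) (\<omega> i) \<partial>traj_law M \<theta> \<mu>) = 0"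
      by (subst nn_integral_traj_law_step[OF M mu _ _ G]) (simp_all add: 0)
    moreover have c: "(\<lambda>\<omega>. \<omega> i) \<in> traj_space \<rightarrow>\<^sub>M (step_space :: ('a \<times> real \<times> 's) measure)"
      by (rule measurable_component_singleton) simp
    have "(\<lambda>\<omega>. ?G (state M i \<omega>) (\<omega> i)) \<in> borel_measurable (traj_law M \<theta> \<mu>)"
      unfolding measurable_cong_sets[OF sets_traj_law[OF M mu] refl]
      by (rule measurable_compose_countable'[where I=UNIV, OF measurable_compose[OF c G] measurable_state]) auto
    ultimately have "AE \<omega> in traj_law M \<theta> \<mu>. ?G (state M i \<omega>) (\<omega> i) = 0"
      by (subst (asm) nn_integral_0_iff_AE) auto
    then show ?thesis
      by eventually_elim (auto simp: indicator_def action_def split: if_splits)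
  qed
  then have "AE \<omega> in traj_law M \<theta> \<mu>. \<forall>i. 0 < outcome_dens M \<theta> (state M i \<omega>) (action i \<omega>) (snd (\<omega> i))"
    by (simp add: AE_all_countable)
  then show ?thesis
    by eventually_elim (auto simp: likelihood_eq_prod_outcome_dens intro!: prod_pos)
qed

text \<open>The integrand is a path product of root density ratios, each weighted by
  \<open>1 / r\<close> when the state is \<open>s\<close>. The conditional mean of a factor is an
  affinity, at most 1 away from \<open>s\<close>, and at \<open>s\<close> at most \<open>r\<close>
  times the weight \<open>1 / r\<close>.\<close>

lemma nn_integral_likelihood_ratio_le_1:
  fixes M :: "('s::finite, 'a::finite, 'p::finite) pmdp"
  assumes M: "param_mdp M" and mu: "\<mu> \<in> candidate_policies M f"
    and r: "0 < r" and aff: "\<And>\<theta>'. affinity M \<theta> \<gamma> s (f \<theta>' s) \<le> ennreal r"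
  shows "(\<integral>\<^sup>+\<omega>. ennreal (sqrt (likelihood M \<gamma> t \<omega> / likelihood M \<theta> t \<omega>) / r ^ visits M s t \<omega>) \<partial>traj_law M \<theta> \<mu>) \<le> 1"
proof -
  let ?w = "\<lambda>s'. if s' = s then 1 / r else 1"
  let ?h = "\<lambda>s' z. outcome_dens M \<gamma> s' (fst z) (snd z) / outcome_dens M \<theta> s' (fst z) (snd z)"
  let ?G = "\<lambda>s' z. ennreal (?w s') * ennreal (sqrt (?h s' z))"
  note meas[measurable] = measurable_outcome_dens[OF M]
  have [measurable]: "(\<lambda>z. outcome_dens M \<theta> s (fst z) (snd z)) \<in> borel_measurable step_space" for s \<theta>
    by (rule measurable_compose_countable'[where I=UNIV and g=fst]) auto
  have pol: "\<mu> \<in> policies"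
    using mu by (simp add: candidate_policies_def)
  have sqrt_prod: "sqrt (\<Prod>i<t. g i) = (\<Prod>i<t. sqrt (g i))" for g :: "nat \<Rightarrow> real"
    by (induction t) (simp_all add: real_sqrt_mult)
  have h: "0 \<le> ?h s' z" for s' z
    by (intro divide_nonneg_nonneg outcome_dens_nonneg M)
  have "ennreal (sqrt (likelihood M \<gamma> t \<omega> / likelihood M \<theta> t \<omega>) / r ^ visits M s t \<omega>) = (\<Prod>i<t. ?G (state M i \<omega>) (\<omega> i))" for \<omega>
  proof -
    have "sqrt (likelihood M \<gamma> t \<omega> / likelihood M \<theta> t \<omega>) / r ^ visits M s t \<omega>
       = sqrt (\<Prod>i<t. ?h (state M i \<omega>) (\<omega> i)) * (1 / r) ^ visits M s t \<omega>"
      by (simp add: likelihood_eq_prod_outcome_dens prod_dividef action_def power_one_over field_simps)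
    also have "\<dots> = (\<Prod>i<t. sqrt (?h (state M i \<omega>) (\<omega> i))) * (\<Prod>i<t. ?w (state M i \<omega>))"
      by (simp only: prod_visits sqrt_prod)
    also have "\<dots> = (\<Prod>i<t. ?w (state M i \<omega>) * sqrt (?h (state M i \<omega>) (\<omega> i)))"
      by (simp add: prod.distrib mult.commute)
    also have "ennreal \<dots> = (\<Prod>i<t. ennreal (?w (state M i \<omega>) * sqrt (?h (state M i \<omega>) (\<omega> i))))"
      using r h by (intro prod_ennreal[symmetric] mult_nonneg_nonneg) auto
    also have "\<dots> = (\<Prod>i<t. ?G (state M i \<omega>) (\<omega> i))"
      using r by (intro prod.cong refl ennreal_mult') auto
    finally show ?thesis .
  qed
  moreover have "(\<integral>\<^sup>+\<omega>. (\<Prod>i<t. ?G (state M i \<omega>) (\<omega> i)) \<partial>traj_law M \<theta> \<mu>) \<le> 1"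
  proof (rule nn_integral_path_prod_le_1[OF M pol])
    fix t and h :: "('s, 'a) traj" and a
    assume h: "h \<in> space (history_space t)" "a \<in> set_pmf (\<mu> t h)"
    let ?s = "state M t h"
    from mu h obtain \<theta>' where a: "a = f \<theta>' ?s"
      by (fastforce simp: candidate_policies_def)
    have "(\<lambda>y. ennreal (sqrt (?h ?s (a, y)))) \<in> borel_measurable (outcome_law M \<theta> ?s a)"
      unfolding measurable_cong_sets[OF sets_outcome_law[OF M] refl] by measurable
    then have "(\<integral>\<^sup>+y. ?G ?s (a, y) \<partial>outcome_law M \<theta> ?s a) = ennreal (?w ?s) * affinity M \<theta> \<gamma> ?s a"
      by (simp add: nn_integral_cmult affinity_def)
    also have "\<dots> \<le> 1"
    proof (cases "?s = s")
      case True
      have "ennreal (1 / r) * affinity M \<theta> \<gamma> s a \<le> ennreal (1 / r) * ennreal r"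
        using aff[of \<theta>'] a True by (intro mult_left_mono) auto
      also have "\<dots> = 1"
        using r by (simp add: ennreal_mult'[symmetric])
      finally show ?thesis using True by simp
    qed (simp add: affinity_le_1[OF M])
    finally show "(\<integral>\<^sup>+y. ?G ?s (a, y) \<partial>outcome_law M \<theta> ?s a) \<le> 1" .
  qed measurable
  ultimately show ?thesis by simp
qed

section \<open>Concentration of the posterior\<close>

lemma uniform_affinity_bound:
  fixes M :: "('s::finite, 'a::finite, 'p::finite) pmdp" and f :: "'p \<Rightarrow> 's \<Rightarrow> 'a"
  assumes M: "param_mdp M" and inform: "\<And>\<theta>'. informative M s (f \<theta>' s)"
  shows "\<exists>r. 0 < r \<and> r < 1 \<and> (\<forall>\<gamma> \<theta>'. \<gamma> \<noteq> \<theta> \<longrightarrow> affinity M \<theta> \<gamma> s (f \<theta>' s) \<le> ennreal r)"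
proof -
  let ?X = "(\<lambda>(\<gamma>, \<theta>'). enn2real (affinity M \<theta> \<gamma> s (f \<theta>' s))) ` ((UNIV - {\<theta>}) \<times> UNIV)"
  \<comment> \<open>A maximum of finitely many numbers below 1. The inserted 1/2 keeps
    \<open>r\<close> positive and the set nonempty even if \<theta> is the only parameter.\<close>
  define r where "r = Max (insert (1/2) ?X)"
  have "affinity M \<theta> \<gamma> s (f \<theta>' s) < 1" if "\<gamma> \<noteq> \<theta>" for \<gamma> \<theta>'
    using inform[of \<theta>'] that unfolding informative_def by (metis affinity_less_1[OF M] less_irrefl)
  then have eq: "affinity M \<theta> \<gamma> s (f \<theta>' s) = ennreal (enn2real (affinity M \<theta> \<gamma> s (f \<theta>' s)))"
    and lt: "enn2real (affinity M \<theta> \<gamma> s (f \<theta>' s)) < 1" if "\<gamma> \<noteq> \<theta>" for \<gamma> \<theta>'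
    using that by (auto simp: enn2real_less_iff order.strict_trans[OF _ ennreal_one_less_top] intro!: ennreal_enn2real[symmetric])
  have "r < 1"
    unfolding r_def by (subst Max_less_iff) (auto simp: lt)
  moreover have "1/2 \<le> r"
    unfolding r_def by (intro Max_ge) auto
  moreover have "affinity M \<theta> \<gamma> s (f \<theta>' s) \<le> ennreal r" if "\<gamma> \<noteq> \<theta>" for \<gamma> \<theta>'
    using that by (subst eq[OF that]) (auto simp: r_def intro!: ennreal_leI Max_ge)
  ultimately show ?thesis
    by (intro exI[of _ r]) auto
qed

lemma evidence_ge:
  fixes M :: "('s::finite, 'a::finite, 'p::finite) pmdp"
  assumes "param_mdp M"
  shows "likelihood M \<gamma> t \<omega> * pmf prior \<gamma> \<le> (\<Sum>\<gamma>\<in>UNIV. likelihood M \<gamma> t \<omega> * pmf prior \<gamma>)"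
  by (rule member_le_sum) (auto intro!: mult_nonneg_nonneg likelihood_nonneg assms)

lemma posterior_le_1:
  fixes M :: "('s::finite, 'a::finite, 'p::finite) pmdp"
  assumes "param_mdp M"
  shows "posterior M prior t \<omega> \<gamma> \<le> 1"
proof -
  have "0 \<le> likelihood M \<gamma> t \<omega> * pmf prior \<gamma>"
    by (simp add: likelihood_nonneg[OF assms])
  with evidence_ge[OF assms, of \<gamma> t \<omega> prior] show ?thesis
    unfolding posterior_def by (auto simp: divide_le_eq_1)
qed

text \<open>The positivity assumptions exclude a zero normalising sum, for which all posterior
  weights would be 0 and not add up to 1.\<close>

lemma one_minus_posterior:
  fixes M :: "('s::finite, 'a::finite, 'p::finite) pmdp"
  assumes M: "param_mdp M" and "0 < likelihood M \<theta> t \<omega>" "0 < pmf prior \<theta>"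
  shows "1 - posterior M prior t \<omega> \<theta> = (\<Sum>\<gamma>\<in>UNIV - {\<theta>}. posterior M prior t \<omega> \<gamma>)"
proof -
  have "0 < likelihood M \<theta> t \<omega> * pmf prior \<theta>"
    using assms by simp
  also note evidence_ge[OF M]
  finally have "(\<Sum>\<gamma>\<in>UNIV. posterior M prior t \<omega> \<gamma>) = 1"
    unfolding posterior_def sum_divide_distrib[symmetric] by simp
  then show ?thesis
    by (subst (asm) sum.remove[of _ \<theta>]) auto
qed

text \<open>Cutting off at \<open>y = \<epsilon>\<close> separates the likelihood ratio from the number of visits
  (with \<open>y = r ^ visits\<close>); this plays the role of the Cauchy--Schwarz inequality.\<close>

lemma posterior_le_cutoff:
  fixes M :: "('s::finite, 'a::finite, 'p::finite) pmdp"
  assumes M: "param_mdp M" and pos: "0 < likelihood M \<theta> t \<omega>" "0 < pmf prior \<theta>"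
    and y: "0 < y" and \<epsilon>: "0 < \<epsilon>"
  shows "posterior M prior t \<omega> \<gamma> \<le>
    \<epsilon> * sqrt (pmf prior \<gamma> / pmf prior \<theta>) * (sqrt (likelihood M \<gamma> t \<omega> / likelihood M \<theta> t \<omega>) / y) + y / \<epsilon>"
proof (cases "y \<le> \<epsilon>")
  case False
  \<comment> \<open>Above the cutoff \<open>y / \<epsilon>\<close> exceeds 1, so the trivial bound
    on the posterior suffices.\<close>
  have "posterior M prior t \<omega> \<gamma> \<le> y / \<epsilon>"
    using False \<epsilon> by (intro order.trans[OF posterior_le_1[OF M]]) (simp add: le_divide_eq)
  also have "\<dots> \<le> \<epsilon> * sqrt (pmf prior \<gamma> / pmf prior \<theta>) * (sqrt (likelihood M \<gamma> t \<omega> / likelihood M \<theta> t \<omega>) / y) + y / \<epsilon>"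
    using \<epsilon> y by (simp add: likelihood_nonneg[OF M])
  finally show ?thesis .
next
  case True
  \<comment> \<open>The posterior odds of \<gamma> against \<theta>. The posterior of \<gamma> is at
    most \<open>min 1 v\<close>, hence at most \<open>sqrt v\<close>; below the cutoff the factor
    \<open>\<epsilon> / y \<ge> 1\<close> may be inserted.\<close>
  define v where "v = likelihood M \<gamma> t \<omega> * pmf prior \<gamma> / (likelihood M \<theta> t \<omega> * pmf prior \<theta>)"
  have v: "0 \<le> v"
    unfolding v_def by (simp add: likelihood_nonneg[OF M])
  have "posterior M prior t \<omega> \<gamma> \<le> v"
    unfolding posterior_def v_def using evidence_ge[OF M, of \<theta> t \<omega> prior] pos
    by (intro divide_left_mono mult_nonneg_nonneg mult_pos_pos likelihood_nonneg[OF M])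
      (auto intro: less_le_trans[of 0 "likelihood M \<theta> t \<omega> * pmf prior \<theta>"])
  then have "posterior M prior t \<omega> \<gamma> \<le> min 1 v"
    using posterior_le_1[OF M] by simp
  also have "\<dots> \<le> sqrt v"
  proof (cases "v \<le> 1")
    case True
    then have "v * v \<le> v" using v by (simp add: mult_left_le)
    then show ?thesis by (simp add: real_le_rsqrt power2_eq_square True)
  qed (simp add: min_def)
  also have "\<dots> \<le> (\<epsilon> / y) * sqrt v"
    using True y v mult_right_mono[of 1 "\<epsilon> / y" "sqrt v"] by (simp add: le_divide_eq)
  also have "\<dots> = \<epsilon> * sqrt (pmf prior \<gamma> / pmf prior \<theta>) * (sqrt (likelihood M \<gamma> t \<omega> / likelihood M \<theta> t \<omega>) / y)"
    unfolding v_def real_sqrt_mult real_sqrt_divide by (simp only: divide_inverse inverse_mult_distrib mult_ac)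
  finally show ?thesis
    using y \<epsilon> by (simp add: add_increasing2)
qed

theorem theorem2:
  fixes M :: "('s::finite, 'a::finite, 'p::finite) pmdp"
    and mu_star :: "'p \<Rightarrow> 's \<Rightarrow> 'a"
    and mu_bar :: "'s \<Rightarrow> 'a"
    and s_star :: 's
    and prior :: "'p pmf"
  assumes mdp: "param_mdp M"
    and opt: "\<And>\<theta>. optimal M \<theta> (mu_star \<theta>)"
    and unichain: "\<And>\<theta>. ergodic_unichain (\<lambda>s. tprob M \<theta> s (mu_star \<theta> s))"
    and inform: "\<And>\<theta>. informative M s_star (mu_star \<theta> s_star)"
    and ergod: "\<And>\<theta>. ergodic (\<lambda>s. tprob M \<theta> s (mu_bar s))"
    and dominate: "\<And>\<mu> \<theta>. \<mu> \<in> candidate_policies M mu_star \<Longrightarrow>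
          visits_dominate M \<theta> s_star \<mu> (stationary M mu_bar)"
    and prior_pos: "\<And>\<theta>. pmf prior \<theta> > 0"
  shows "\<forall>\<theta>. \<exists>a > 0. \<exists>b > 0. \<forall>t::nat.
    (\<integral>\<omega>. (1 - posterior M prior t \<omega> \<theta>) \<partial>traj_law M \<theta> (thompson M prior mu_star))
      \<le> a * exp (- b * real t)"
proof
  fix \<theta>
  let ?\<mu> = "thompson M prior mu_star"
  let ?P = "traj_law M \<theta> ?\<mu>"
  let ?K = "\<lambda>s. tprob M \<theta> s (mu_bar s)"
  let ?N = "\<lambda>t \<omega>. visits M s_star t \<omega>"
  have cand: "?\<mu> \<in> candidate_policies M mu_star"
    by (rule thompson_candidate[OF mdp])
  then have pol: "?\<mu> \<in> policies"
    by (simp add: candidate_policies_def)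
  interpret prob_space ?P
    by (rule prob_space_traj_law[OF mdp pol])
  note sets[measurable_cong] = sets_traj_law[OF mdp pol, of \<theta>]
  note [measurable] = likelihood_measurable[OF mdp, where J=UNIV, simplified]
  obtain r where r: "0 < r" "r < 1"
    and aff: "\<And>\<gamma> \<theta>'. \<gamma> \<noteq> \<theta> \<Longrightarrow> affinity M \<theta> \<gamma> s_star (mu_star \<theta>' s_star) \<le> ennreal r"
    using uniform_affinity_bound[OF mdp, where s=s_star and f=mu_star and \<theta>=\<theta>] inform by metis
  have "\<And>x. accessible ?K x s_star"
    using ergod[of \<theta>] by (simp add: ergodic_def)
  from visit_transform_exponential_decay[OF r this] obtain A b where A: "0 < A" and b: "0 < b"
    and decay: "\<And>t x. visit_transform ?K s_star r t x \<le> A * exp (- b * real t)"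
    by blast
  have visits_decay: "(\<integral>\<^sup>+\<omega>. ennreal (r ^ ?N t \<omega>) \<partial>?P) \<le> ennreal (A * exp (- b * real t))" for t
  proof -
    have "(\<integral>\<^sup>+\<omega>. ennreal r ^ ?N t \<omega> \<partial>?P) \<le> (\<integral>\<^sup>+\<omega>. ennreal r ^ ?N t \<omega> \<partial>traj_law M \<theta> (stationary M mu_bar))"
      using r by (intro nn_integral_visits_dominate dominate cand) auto
    also have "\<dots> = ennreal (visit_transform ?K s_star r t (start M))"
      using nn_integral_visits_stationary[OF mdp, where r=r and s=s_star and t=t and k=0 and \<theta>=\<theta> and f=mu_bar] r by simp
    also have "\<dots> \<le> ennreal (A * exp (- b * real t))"
      by (intro ennreal_leI decay)
    finally show ?thesis
      using r by (simp add: ennreal_power)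
  qed
  define c where "c \<gamma> = sqrt (pmf prior \<gamma> / pmf prior \<theta>)" for \<gamma>
  have c: "0 \<le> c \<gamma>" for \<gamma>
    by (simp add: c_def)
  \<comment> \<open>Each rival \<gamma> contributes \<open>c \<gamma>\<close> from the likelihood
    ratio and \<open>A\<close> from the visits. The added 1 keeps \<open>a\<close> positive when
    there is no rival.\<close>
  define a where "a = (\<Sum>\<gamma>\<in>UNIV - {\<theta>}. c \<gamma> + A) + 1"
  have sum0: "0 \<le> (\<Sum>\<gamma>\<in>UNIV - {\<theta>}. c \<gamma> + A)"
    using c A by (intro sum_nonneg) (simp add: add_nonneg_nonneg)
  have "(\<integral>\<omega>. (1 - posterior M prior t \<omega> \<theta>) \<partial>?P) \<le> a * exp (- (b / 2) * real t)" for t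
  proof -
    \<comment> \<open>The cutoff level balances the two terms: the visit bound is
      \<open>A * \<epsilon> * \<epsilon>\<close>, which after division by \<epsilon> has the same
      order \<epsilon> as the ratio term. Hence the halved rate \<open>b / 2\<close>.\<close>
    define \<epsilon> where "\<epsilon> = exp (- (b / 2) * real t)"
    have \<epsilon>: "0 < \<epsilon>"
      by (simp add: \<epsilon>_def)
    have decay_\<epsilon>: "A * exp (- b * real t) = A * \<epsilon> * \<epsilon>"
      by (simp add: \<epsilon>_def exp_add[symmetric] mult.assoc)
    let ?X = "\<lambda>\<gamma> \<omega>. sqrt (likelihood M \<gamma> t \<omega> / likelihood M \<theta> t \<omega>) / r ^ ?N t \<omega>"
    have [measurable]: "(\<lambda>\<omega>. ennreal (r ^ ?N t \<omega>)) \<in> borel_measurable ?P"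
      using measurable_power_visits[of t UNIV "ennreal r" M s_star] r
      by (simp add: ennreal_power cong: measurable_cong_sets[OF sets])
    \<comment> \<open>Path products are treated in \<open>ennreal\<close>; the real version is
      recovered through \<open>enn2real\<close>.\<close>
    have [measurable]: "(\<lambda>\<omega>. r ^ ?N t \<omega>) \<in> borel_measurable ?P"
      using borel_measurable_enn2real[OF \<open>(\<lambda>\<omega>. ennreal (r ^ ?N t \<omega>)) \<in> borel_measurable ?P\<close>] r
      by (simp del: ennreal_power)
    have Xm[measurable]: "(\<lambda>\<omega>. ennreal (?X \<gamma> \<omega>)) \<in> borel_measurable ?P" for \<gamma>
      by measurable
    have X: "0 \<le> ?X \<gamma> \<omega>" for \<gamma> \<omega>
      using r by (simp add: likelihood_nonneg[OF mdp])
    have "(\<integral>\<^sup>+\<omega>. ennreal (1 - posterior M prior t \<omega> \<theta>) \<partial>?P)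
       \<le> (\<integral>\<^sup>+\<omega>. (\<Sum>\<gamma>\<in>UNIV - {\<theta>}. ennreal (\<epsilon> * c \<gamma>) * ennreal (?X \<gamma> \<omega>) + ennreal (1 / \<epsilon>) * ennreal (r ^ ?N t \<omega>)) \<partial>?P)"
    proof (rule nn_integral_mono_AE)
      show "AE \<omega> in ?P. ennreal (1 - posterior M prior t \<omega> \<theta>) \<le>
        (\<Sum>\<gamma>\<in>UNIV - {\<theta>}. ennreal (\<epsilon> * c \<gamma>) * ennreal (?X \<gamma> \<omega>) + ennreal (1 / \<epsilon>) * ennreal (r ^ ?N t \<omega>))"
        using AE_likelihood_pos[OF mdp pol, of \<theta> t]
      proof eventually_elim
        case (elim \<omega>)
        have "1 - posterior M prior t \<omega> \<theta> \<le> (\<Sum>\<gamma>\<in>UNIV - {\<theta>}. \<epsilon> * c \<gamma> * ?X \<gamma> \<omega> + r ^ ?N t \<omega> / \<epsilon>)"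
          unfolding one_minus_posterior[OF mdp elim prior_pos] c_def
          using r \<epsilon> by (intro sum_mono posterior_le_cutoff mdp elim prior_pos) auto
        then have "ennreal (1 - posterior M prior t \<omega> \<theta>) \<le> ennreal (\<Sum>\<gamma>\<in>UNIV - {\<theta>}. \<epsilon> * c \<gamma> * ?X \<gamma> \<omega> + r ^ ?N t \<omega> / \<epsilon>)"
          by (rule ennreal_leI)
        also have "\<dots> = (\<Sum>\<gamma>\<in>UNIV - {\<theta>}. ennreal (\<epsilon> * c \<gamma> * ?X \<gamma> \<omega> + r ^ ?N t \<omega> / \<epsilon>))"
          using r \<epsilon> c X by (intro sum_ennreal[symmetric] add_nonneg_nonneg mult_nonneg_nonneg) auto
        also have "\<dots> = (\<Sum>\<gamma>\<in>UNIV - {\<theta>}. ennreal (\<epsilon> * c \<gamma>) * ennreal (?X \<gamma> \<omega>) + ennreal (1 / \<epsilon>) * ennreal (r ^ ?N t \<omega>))"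
        proof (intro sum.cong refl)
          fix \<gamma>
          have "0 \<le> \<epsilon> * c \<gamma> * ?X \<gamma> \<omega>" "0 \<le> r ^ ?N t \<omega> / \<epsilon>" "0 \<le> \<epsilon> * c \<gamma>" "0 \<le> 1 / \<epsilon>"
            using r \<epsilon> c[of \<gamma>] X[of \<gamma> \<omega>] mult_nonneg_nonneg[OF mult_nonneg_nonneg[of \<epsilon> "c \<gamma>"] X[of \<gamma> \<omega>]] by simp_all
          then show "ennreal (\<epsilon> * c \<gamma> * ?X \<gamma> \<omega> + r ^ ?N t \<omega> / \<epsilon>)
            = ennreal (\<epsilon> * c \<gamma>) * ennreal (?X \<gamma> \<omega>) + ennreal (1 / \<epsilon>) * ennreal (r ^ ?N t \<omega>)"
            using ennreal_mult'[of "\<epsilon> * c \<gamma>" "?X \<gamma> \<omega>"] ennreal_mult'[of "1 / \<epsilon>" "r ^ ?N t \<omega>"] by simp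
        qed
        finally show ?case .
      qed
    qed
    also have "\<dots> = (\<Sum>\<gamma>\<in>UNIV - {\<theta>}. ennreal (\<epsilon> * c \<gamma>) * (\<integral>\<^sup>+\<omega>. ennreal (?X \<gamma> \<omega>) \<partial>?P) +
        ennreal (1 / \<epsilon>) * (\<integral>\<^sup>+\<omega>. ennreal (r ^ ?N t \<omega>) \<partial>?P))"
      by (simp add: nn_integral_sum nn_integral_add nn_integral_cmult del: ennreal_power)
    \<comment> \<open>The two estimates meet here: the supermartingale bound for the weighted root
      ratio, and the decay inherited from the chain of \<open>mu_bar\<close> for the visits.\<close>
    also have "\<dots> \<le> (\<Sum>\<gamma>\<in>UNIV - {\<theta>}. ennreal (\<epsilon> * c \<gamma>) * 1 + ennreal (1 / \<epsilon>) * ennreal (A * \<epsilon> * \<epsilon>))"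
      using visits_decay[of t] unfolding decay_\<epsilon>
      by (intro sum_mono add_mono mult_left_mono nn_integral_likelihood_ratio_le_1[OF mdp cand r(1) aff]) auto
    also have "\<dots> = (\<Sum>\<gamma>\<in>UNIV - {\<theta>}. ennreal ((c \<gamma> + A) * \<epsilon>))"
      using \<epsilon> c A
      by (intro sum.cong refl) (simp add: ennreal_mult'[symmetric] ennreal_plus[symmetric] algebra_simps del: ennreal_plus)
    also have "\<dots> = ennreal (\<Sum>\<gamma>\<in>UNIV - {\<theta>}. (c \<gamma> + A) * \<epsilon>)"
      using \<epsilon> c A by (intro sum_ennreal) (simp add: add_nonneg_nonneg)
    also have "\<dots> \<le> ennreal (a * \<epsilon>)"
      using \<epsilon> by (intro ennreal_leI) (simp add: a_def sum_distrib_right distrib_right)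
    finally have *: "(\<integral>\<^sup>+\<omega>. ennreal (1 - posterior M prior t \<omega> \<theta>) \<partial>?P) \<le> ennreal (a * \<epsilon>)" .
    have "(\<lambda>\<omega>. 1 - posterior M prior t \<omega> \<theta>) \<in> borel_measurable ?P"
      unfolding posterior_def by measurable
    then have "(\<integral>\<omega>. (1 - posterior M prior t \<omega> \<theta>) \<partial>?P) = enn2real (\<integral>\<^sup>+\<omega>. ennreal (1 - posterior M prior t \<omega> \<theta>) \<partial>?P)"
      by (rule integral_eq_nn_integral) (simp add: posterior_le_1[OF mdp])
    also have "\<dots> \<le> a * \<epsilon>"
      using * by (rule enn2real_leI[rotated]) (use \<epsilon> sum0 in \<open>simp add: a_def\<close>)
    finally show ?thesis
      by (simp add: \<epsilon>_def)
  qed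
  moreover have "0 < a" "0 < b / 2"
    using sum0 b by (auto simp: a_def)
  ultimately show "\<exists>a>0. \<exists>b>0. \<forall>t::nat. (\<integral>\<omega>. (1 - posterior M prior t \<omega> \<theta>) \<partial>?P) \<le> a * exp (- b * real t)"
    by blast
qed

end
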